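(* Let $\Lambda$ be a finite set, let $\tau:\Lambda^{\mathbb{N}_0}\to\Lambda^{\mathbb{N}_0}$ be a bi-permutative cellular automaton, and let $\mu$ be a shift-invariant Borel probability measure on $\Lambda^{\mathbb{N}_0}$ which is also invariant relative to $\tau$. Let $\mathcal{B}$ be the Borel $\sigma$-algebra of $\Lambda^{\mathbb{N}_0}$. Then the function $x\mapsto \mu_x^{\sigma^{-1}\mathcal{B}}(\{x\})$ is $\tau$-invariant ($\mu$-almost-surely) and is measurable with respect to the Pinsker $\sigma$-algebras of both maps $\sigma$ and $\tau$ (relative to $\mu$), which are equal; and, when considered as a probability measure on $\Lambda$, $\mu_x^{\sigma^{-1}\mathcal{B}}$ is $\mu$-almost-surely the uniform probability on a subset $\Lambda_{\mu,x}\subseteq\Lambda$.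
   Context: $\mathbb{N}_0$ is the set of non-negative integers and $\sigma$ is the left shift on $\Lambda^{\mathbb{N}_0}$, $(\sigma(x))_i=x_{i+1}$. A bi-permutative cellular automaton is a map $\tau:\Lambda^{\mathbb{N}_0}\to\Lambda^{\mathbb{N}_0}$ of the form $(\tau(x))_i=r(x_i,x_{i+1})$ for some function $r:\Lambda^2\to\Lambda$ such that for every fixed $a\in\Lambda$ both $r(\cdot,a):\Lambda\to\Lambda$ (left permutativity) and $r(a,\cdot):\Lambda\to\Lambda$ (right permutativity) are bijective. For a sub-$\sigma$-algebra $\mathcal{A}\subseteq\mathcal{B}$, $\mu_x^{\mathcal{A}}$ denotes the conditional probability measure of $\mu$ with respect to $\mathcal{A}$ at $x$ (disintegration of $\mu$ over $\mathcal{A}$). The measure $\mu_x^{\sigma^{-1}\mathcal{B}}$ is supported on the atom $\{y: y_i=x_i \text{ for all } i\ge 1\}$ and is considered as a probability measure on $\Lambda$ through $y\mapsto y_0$. $\sigma$-algebras and measurability are understood modulo $\mu$-null sets. *)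

theory Defs
  imports "HOL-Probability.Probability"
begin

definition shift :: "(nat \<Rightarrow> 'a) \<Rightarrow> nat \<Rightarrow> 'a" where
  "shift x = (\<lambda>i. x (Suc i))"

definition bipermutative_ca :: "((nat \<Rightarrow> 'a) \<Rightarrow> nat \<Rightarrow> 'a) \<Rightarrow> bool" where
  "bipermutative_ca \<tau> \<longleftrightarrow>
     (\<exists>r :: 'a \<Rightarrow> 'a \<Rightarrow> 'a. (\<forall>a. bij (\<lambda>b. r b a)) \<and> (\<forall>a. bij (\<lambda>b. r a b)) \<and>
        (\<forall>x i. \<tau> x i = r (x i) (x (Suc i))))"

text \<open>The Borel \<open>\<sigma>\<close>-algebra of the product of discrete spaces; see \<open>sets_seq_borel\<close> below for
  the agreement with the product \<open>\<sigma>\<close>-algebra.\<close>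

definition seq_borel :: "(nat \<Rightarrow> 'a) measure" where
  "seq_borel = sigma UNIV {U. openin (product_topology (\<lambda>_. discrete_topology UNIV) UNIV) U}"

definition invariant_measure :: "'x measure \<Rightarrow> ('x \<Rightarrow> 'x) \<Rightarrow> bool" where
  "invariant_measure M T \<longleftrightarrow> T \<in> M \<rightarrow>\<^sub>M M \<and> distr M M T = M"

text \<open>Finite measurable partitions are represented by their sets of atoms. The empty set may
  occur among the atoms; it contributes \<open>0\<close> to the entropy because \<open>0 * ln 0 = 0\<close>.\<close>

definition partition_entropy :: "'x measure \<Rightarrow> 'x set set \<Rightarrow> real" where
  "partition_entropy M P = - (\<Sum>A\<in>P. measure M A * ln (measure M A))"

definition partition_join :: "'x set set \<Rightarrow> 'x set set \<Rightarrow> 'x set set" where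
  "partition_join P Q = {A \<inter> B | A B. A \<in> P \<and> B \<in> Q}"

definition partition_preimage :: "'x measure \<Rightarrow> ('x \<Rightarrow> 'x) \<Rightarrow> 'x set set \<Rightarrow> 'x set set" where
  "partition_preimage M T P = {T -` A \<inter> space M | A. A \<in> P}"

text \<open>\<open>iterated_join M T P n\<close> is the join of the partitions \<open>T\<^sup>-\<^sup>i P\<close> with \<open>i < n\<close>.\<close>

fun iterated_join :: "'x measure \<Rightarrow> ('x \<Rightarrow> 'x) \<Rightarrow> 'x set set \<Rightarrow> nat \<Rightarrow> 'x set set" where
  "iterated_join M T P 0 = {space M}"
| "iterated_join M T P (Suc n) =
     partition_join (iterated_join M T P n) (partition_preimage M (T ^^ n) P)"

definition ks_entropy :: "'x measure \<Rightarrow> ('x \<Rightarrow> 'x) \<Rightarrow> 'x set set \<Rightarrow> real" where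
  "ks_entropy M T P = lim (\<lambda>n. partition_entropy M (iterated_join M T P n) / real n)"

text \<open>For an invariant probability measure the generating collection is itself a
  \<open>\<sigma>\<close>-algebra, and it contains every measurable null set. Hence equality of the \<open>sets\<close> of two
  Pinsker algebras of \<open>M\<close> is the same as their equality modulo null sets.\<close>

definition pinsker_algebra :: "'x measure \<Rightarrow> ('x \<Rightarrow> 'x) \<Rightarrow> 'x measure" where
  "pinsker_algebra M T = sigma (space M) {A \<in> sets M. ks_entropy M T {A, space M - A} = 0}"

text \<open>\<open>\<kappa>\<close> is a version of the family of conditional measures of \<open>M\<close> with respect to the
  sub-\<open>\<sigma>\<close>-algebra \<open>F\<close>.\<close>

definition conditional_measures :: "'x measure \<Rightarrow> 'x measure \<Rightarrow> ('x \<Rightarrow> 'x measure) \<Rightarrow> bool" where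
  "conditional_measures M F \<kappa> \<longleftrightarrow>
     subalgebra M F \<and> \<kappa> \<in> F \<rightarrow>\<^sub>M prob_algebra M \<and>
     (\<forall>A\<in>sets M. AE x in M. measure (\<kappa> x) A = real_cond_exp M F (indicator A) x)"

definition shift_past :: "(nat \<Rightarrow> 'a) measure \<Rightarrow> (nat \<Rightarrow> 'a) measure" where
  "shift_past M = vimage_algebra (space M) shift M"

lemma space_seq_borel [simp]: "space seq_borel = UNIV"
  by (simp add: seq_borel_def)

lemma sets_seq_borel:
  "sets (seq_borel :: (nat \<Rightarrow> 'a::finite) measure) = sets (PiM UNIV (\<lambda>_. count_space UNIV))"
proof
  let ?P = "PiM UNIV (\<lambda>_::nat. count_space (UNIV :: 'a set))"
  let ?T = "product_topology (\<lambda>_::nat. discrete_topology (UNIV :: 'a set)) UNIV"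
  let ?cyl = "\<lambda>w. {x. \<forall>i<length w. x i = w ! i} :: (nat \<Rightarrow> 'a) set"
  have cyl: "?cyl w \<in> sets ?P" for w
  proof -
    have "?cyl w = {x \<in> space ?P. \<forall>i\<in>{..<length w}. x i = w ! i}"
      by (auto simp: space_PiM)
    also have "\<dots> \<in> sets ?P" by measurable
    finally show ?thesis .
  qed
  have "U \<in> sets ?P" if U: "openin ?T U" for U
  proof -
    have "\<exists>w. x \<in> ?cyl w \<and> ?cyl w \<subseteq> U" if "x \<in> U" for x
    proof -
      from U that obtain V where V: "finite {i. V i \<noteq> UNIV}" "x \<in> Pi\<^sub>E UNIV V" "Pi\<^sub>E UNIV V \<subseteq> U"
        unfolding openin_product_topology_alt by auto
      obtain N where N: "\<And>i. V i \<noteq> UNIV \<Longrightarrow> i < N"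
        using finite_nat_set_iff_bounded[THEN iffD1, OF V(1)] by auto
      have "?cyl (map x [0..<N]) \<subseteq> Pi\<^sub>E UNIV V"
        using V(2) N by (fastforce simp: PiE_def Pi_def)
      then show ?thesis using V(3) by (intro exI[of _ "map x [0..<N]"]) auto
    qed
    then have "U = (\<Union>w\<in>{w. ?cyl w \<subseteq> U}. ?cyl w)" by blast
    also have "\<dots> \<in> sets ?P"
      by (intro sets.countable_UN') (auto intro: cyl)
    finally show ?thesis .
  qed
  then show "sets (seq_borel :: (nat \<Rightarrow> 'a) measure) \<subseteq> sets ?P"
    unfolding seq_borel_def
    by (subst sets_measure_of) (auto intro!: sets.sigma_sets_subset[of _ ?P, simplified space_PiM, simplified])
next
  let ?T = "product_topology (\<lambda>_::nat. discrete_topology (UNIV :: 'a set)) UNIV"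
  have "{x. x i \<in> A} \<in> sets (seq_borel :: (nat \<Rightarrow> 'a) measure)" for i :: nat and A :: "'a set"
  proof -
    have "openin ?T {x \<in> topspace ?T. x i \<in> A}"
      by (rule openin_continuous_map_preimage[of _ "discrete_topology UNIV"])
         (auto intro: continuous_map_product_projection)
    then show ?thesis by (auto simp: seq_borel_def)
  qed
  then have "(\<lambda>x. x) \<in> (seq_borel :: (nat \<Rightarrow> 'a) measure) \<rightarrow>\<^sub>M PiM UNIV (\<lambda>_. count_space UNIV)"
    by (intro measurable_PiM_single) (auto simp: space_PiM)
  then show "sets (PiM UNIV (\<lambda>_. count_space UNIV)) \<subseteq> sets (seq_borel :: (nat \<Rightarrow> 'a) measure)"
    by (auto simp: measurable_def space_PiM)
qed

text \<open>Conditional measures with respect to the \<open>\<sigma>\<close>-algebra of \<open>shift\<close> exist, so quantifying over all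
  their versions is not vacuous.\<close>

lemma ex_conditional_measures:
  fixes M :: "(nat \<Rightarrow> 'a::finite) measure"
  assumes "prob_space M" and sM: "sets M = sets seq_borel" and inv: "invariant_measure M shift"
  shows "\<exists>\<kappa>. conditional_measures M (shift_past M) \<kappa>"
proof -
  interpret prob_space M by fact
  define F where "F = shift_past M"
  have spM: "space M = UNIV" using sets_eq_imp_space_eq[OF sM] by simp
  have spF: "space F = UNIV" by (simp add: F_def shift_past_def spM)
  have shM [measurable]: "shift \<in> M \<rightarrow>\<^sub>M M" using inv by (simp add: invariant_measure_def)
  have shF [measurable]: "shift \<in> F \<rightarrow>\<^sub>M M"
    unfolding F_def shift_past_def by (rule measurable_vimage_algebra1) (simp add: spM)
  have sub: "subalgebra M F"
    using measurable_sets[OF shM]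
    by (auto simp: subalgebra_def F_def shift_past_def spM sets_vimage_algebra2)
  interpret finite_measure_subalgebra M F
    by (unfold_locales) (rule sub)
  have sP: "sets M = sets (PiM UNIV (\<lambda>_. count_space UNIV))"
    by (simp add: sM sets_seq_borel)
  have ev: "(\<lambda>y. y i) \<in> M \<rightarrow>\<^sub>M count_space UNIV" for i
    unfolding measurable_cong_sets[OF sP refl] by (rule measurable_component_singleton) simp
  define Z where "Z a = {y :: nat \<Rightarrow> 'a. y 0 = a}" for a
  have Z [measurable]: "Z a \<in> sets M" for a
    using measurable_sets[OF ev, of "{a}" 0] by (simp add: Z_def vimage_def spM)
  define ext where "ext a x = case_nat a x" for a and x :: "nat \<Rightarrow> 'a"
  have ext [measurable]: "ext a \<in> M \<rightarrow>\<^sub>M M" for a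
  proof -
    have "ext a \<in> M \<rightarrow>\<^sub>M PiM UNIV (\<lambda>_. count_space UNIV)"
    proof (rule measurable_PiM_single')
      show "(\<lambda>x. ext a x i) \<in> M \<rightarrow>\<^sub>M count_space UNIV" for i
        by (cases i) (simp_all add: ext_def ev)
    qed (auto simp: space_PiM)
    then show ?thesis by (simp add: measurable_cong_sets[OF refl sP])
  qed
  define p where "p a = real_cond_exp M F (indicator (Z a))" for a
  have p [measurable]: "p a \<in> borel_measurable F" for a by (simp add: p_def)
  have int [simp]: "integrable M (indicator A :: _ \<Rightarrow> real)" if "A \<in> sets M" for A
    using that by (simp add: integrable_indicator_iff less_top[symmetric])
  define good where "good x \<longleftrightarrow> (\<forall>a. 0 \<le> p a x) \<and> (\<Sum>a\<in>UNIV. p a x) = 1" for x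
  have good_meas [measurable]: "Measurable.pred F good" unfolding good_def by measurable
  have AE_good: "AE x in M. good x"
  proof -
    have 1: "AE x in M. \<forall>a. 0 \<le> p a x"
      unfolding p_def by (intro AE_all_countable[THEN iffD2] allI real_cond_exp_pos) auto
    have "(\<lambda>x. \<Sum>a\<in>UNIV. indicator (Z a) x :: real) = (\<lambda>_. 1)"
      by (auto simp: Z_def indicator_def fun_eq_iff)
    then have "AE x in M. (\<Sum>a\<in>UNIV. p a x) = real_cond_exp M F (\<lambda>_. 1) x"
      using real_cond_exp_sum[of "\<lambda>a. indicator (Z a)" UNIV] by (simp add: p_def eq_commute)
    moreover have "AE x in M. real_cond_exp M F (\<lambda>_. 1 :: real) x = 1"
      by (rule real_cond_exp_F_meas) auto
    ultimately show ?thesis using 1 by eventually_elim (simp add: good_def)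
  qed
  define q where "q x a = (if good x then p a x else if a = undefined then 1 else 0)" for x a
  have q [measurable]: "(\<lambda>x. q x a) \<in> borel_measurable F" for a unfolding q_def by measurable
  have q0: "0 \<le> q x a" for x a by (auto simp: q_def good_def)
  have q1: "(\<Sum>a\<in>UNIV. q x a) = 1" for x
    by (cases "good x") (simp_all add: q_def, simp add: good_def)
  have pq: "pmf (embed_pmf (q x)) a = q x a" for x a
    by (rule pmf_embed_pmf)
       (simp_all add: q0 nn_integral_count_space_finite sum_ennreal q1)
  define \<kappa> where "\<kappa> x = distr (measure_pmf (embed_pmf (q x))) M (\<lambda>a. ext a (shift x))" for x
  have mk: "(\<lambda>a. ext a y) \<in> measure_pmf D \<rightarrow>\<^sub>M M" for y D by (simp add: spM)
  have prob_\<kappa>: "prob_space (\<kappa> x)" for x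
    unfolding \<kappa>_def by (intro measure_pmf.prob_space_distr mk)
  have \<kappa>_eq: "measure (\<kappa> x) A = (\<Sum>a\<in>UNIV. q x a * indicator A (ext a (shift x)))"
    if "A \<in> sets M" for A x
  proof -
    have "measure (\<kappa> x) A = measure (embed_pmf (q x)) {a. ext a (shift x) \<in> A}"
      using that unfolding \<kappa>_def by (subst measure_distr[OF mk]) (auto simp: vimage_def)
    also have "\<dots> = (\<Sum>a\<in>{a. ext a (shift x) \<in> A}. q x a)"
      by (simp add: measure_measure_pmf_finite pq)
    also have "\<dots> = (\<Sum>a\<in>UNIV. q x a * indicator A (ext a (shift x)))"
      by (auto intro!: sum.mono_neutral_cong_left simp: indicator_def)
    finally show ?thesis .
  qed
  have ind [measurable]: "(\<lambda>x. indicator A (ext a (shift x)) :: real) \<in> borel_measurable F"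
    if "A \<in> sets M" for A a using that by measurable
  have "\<kappa> \<in> F \<rightarrow>\<^sub>M prob_algebra M"
  proof (intro measurable_prob_algebraI measurable_subprob_algebra prob_\<kappa>)
    show "subprob_space (\<kappa> x)" for x using prob_\<kappa> by (rule prob_space_imp_subprob_space)
    show "sets (\<kappa> x) = sets M" for x by (simp add: \<kappa>_def)
    fix A assume A [measurable]: "A \<in> sets M"
    have "emeasure (\<kappa> x) A = ennreal (\<Sum>a\<in>UNIV. q x a * indicator A (ext a (shift x)))" for x
      using finite_measure.emeasure_eq_measure[OF prob_space.finite_measure[OF prob_\<kappa>]] \<kappa>_eq[OF A]
      by simp
    then have "(\<lambda>x. emeasure (\<kappa> x) A) =
        (\<lambda>x. ennreal (\<Sum>a\<in>UNIV. q x a * indicator A (ext a (shift x))))" by blast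
    also have "\<dots> \<in> borel_measurable F"
      by (intro measurable_compose[OF _ measurable_ennreal] borel_measurable_sum
            borel_measurable_times q ind A)
    finally show "(\<lambda>x. emeasure (\<kappa> x) A) \<in> borel_measurable F" .
  qed
  moreover have "AE x in M. measure (\<kappa> x) A = real_cond_exp M F (indicator A) x"
    if A [measurable]: "A \<in> sets M" for A
  proof -
    let ?g = "\<lambda>a x. indicator A (ext a (shift x)) :: real"
    have I: "(\<lambda>x. ?g a x * indicator (Z a) x) = indicator ((\<lambda>x. ext a (shift x)) -` A \<inter> space M \<inter> Z a)"
      for a by (auto simp: fun_eq_iff indicator_def spM)
    have intg: "integrable M (\<lambda>x. ?g a x * indicator (Z a) x)" for a
      unfolding I by (rule int) measurable
    have "AE x in M. real_cond_exp M F (\<lambda>x. ?g a x * indicator (Z a) x) x = ?g a x * p a x" for a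
      unfolding p_def by (rule real_cond_exp_mult) (use intg in auto)
    then have 1: "AE x in M. \<forall>a. real_cond_exp M F (\<lambda>x. ?g a x * indicator (Z a) x) x = ?g a x * p a x"
      by (simp add: AE_all_countable)
    have "(\<Sum>a\<in>UNIV. ?g a x * indicator (Z a) x) = indicator A x" for x
    proof -
      have "(\<Sum>a\<in>UNIV. ?g a x * indicator (Z a) x) = ?g (x 0) x"
        by (subst sum.remove[of _ "x 0"]) (auto simp: Z_def indicator_def)
      moreover have "ext (x 0) (shift x) = x"
        by (auto simp: ext_def shift_def fun_eq_iff split: nat.split)
      ultimately show ?thesis by simp
    qed
    then have "AE x in M. real_cond_exp M F (indicator A) x =
        (\<Sum>a\<in>UNIV. real_cond_exp M F (\<lambda>x. ?g a x * indicator (Z a) x) x)"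
      using real_cond_exp_sum[of "\<lambda>a x. ?g a x * indicator (Z a) x" UNIV, OF intg] by simp
    with 1 AE_good show ?thesis
      by eventually_elim (simp add: \<kappa>_eq[OF A] q_def mult.commute)
  qed
  ultimately show ?thesis using sub by (auto simp: conditional_measures_def F_def)
qed

end

theory Submission
  imports Defs "HOL-Real_Asymp.Real_Asymp"
begin

text \<open>Let \<open>\<alpha>\<close> be the partition according to \<open>x\<^sub>0\<close>. By right permutativity the joins
  \<open>\<Or>\<^sub>i\<^sub><\<^sub>n \<sigma>\<^sup>-\<^sup>i \<alpha>\<close> and \<open>\<Or>\<^sub>i\<^sub><\<^sub>n \<tau>\<^sup>-\<^sup>i \<alpha>\<close> coincide; call them \<open>\<alpha>\<^sub>n\<close>, and let \<open>h\<close> be the limit of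
  \<open>H(\<alpha>\<^sub>n) / n\<close>. A partition \<open>\<eta>\<close> of zero \<open>\<sigma>\<close>-entropy satisfies \<open>H(\<alpha>\<^sub>n | \<eta>) \<ge> n h\<close>. If \<open>\<xi>\<close> has zero
  \<open>\<sigma>\<close>-entropy, then so does \<open>\<eta> = \<Or>\<^sub>i\<^sub><\<^sub>n \<tau>\<^sup>-\<^sup>i \<xi>\<close>, and hence
  \<open>H(\<eta>) = H(\<alpha>\<^sub>n \<or> \<eta>) - H(\<alpha>\<^sub>n | \<eta>) \<le> n h + o(n) - n h\<close>, so that \<open>\<xi>\<close> has zero \<open>\<tau>\<close>-entropy. The
  situation is symmetric in \<open>\<sigma>\<close> and \<open>\<tau>\<close>, so the Pinsker algebras agree.

  Write \<open>p\<^sub>a(x)\<close> for the conditional probability of \<open>x\<^sub>0 = a\<close> given \<open>\<sigma>\<^sup>-\<^sup>1\<B>\<close>. Both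
  \<open>p\<^sub>b \<circ> \<tau>\<close> and the conditional probability \<open>v\<^sub>b\<close> of \<open>(\<tau> x)\<^sub>0 = b\<close> given \<open>\<sigma>\<^sup>-\<^sup>1\<B>\<close> have, summed over \<open>b\<close>, the
  same squared \<open>L\<^sup>2\<close>-norm, because by left permutativity the \<open>v\<^sub>b\<close> are a permutation of the \<open>p\<^sub>a\<close>; since
  \<open>p\<^sub>b \<circ> \<tau>\<close> is a projection of \<open>v\<^sub>b\<close>, they agree. This gives the \<open>\<tau>\<close>-invariance of
  \<open>J(x) = \<mu>\<^sub>x({x})\<close>. Its level sets then have zero \<open>\<tau>\<close>-entropy, hence zero \<open>\<sigma>\<close>-entropy, hence are
  \<open>\<sigma>\<^sup>-\<^sup>1\<B>\<close>-measurable modulo null sets. So \<open>J\<close> is \<open>\<mu>\<^sub>x\<close>-almost surely constant, which forces \<open>\<mu>\<^sub>x\<close> to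
  be uniform on its atoms.\<close>

subsection \<open>Shannon entropy of simple functions\<close>

text \<open>Shannon entropy in nats, written over the fibres of \<open>X\<close> so that it matches
  \<open>partition_entropy\<close> term by term. Only the partition into fibres matters, so the
  value type may change freely.\<close>

definition ent :: "'x measure \<Rightarrow> ('x \<Rightarrow> 'b) \<Rightarrow> real" where
  "ent M X = - (\<Sum>v\<in>X ` space M. measure M (X -` {v} \<inter> space M) * ln (measure M (X -` {v} \<inter> space M)))"

text \<open>Defined by the chain rule, which avoids any conditioning on single fibres.\<close>

definition cond_ent :: "'x measure \<Rightarrow> ('x \<Rightarrow> 'b) \<Rightarrow> ('x \<Rightarrow> 'c) \<Rightarrow> real" where
  "cond_ent M X Y = ent M (\<lambda>x. (X x, Y x)) - ent M Y"

lemma ent_eq_sum_superset: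
  assumes "finite V" "X ` space M \<subseteq> V"
  shows "ent M X = - (\<Sum>v\<in>V. measure M (X -` {v} \<inter> space M) * ln (measure M (X -` {v} \<inter> space M)))"
proof -
  have "X -` {v} \<inter> space M = {}" if "v \<notin> X ` space M" for v
    using that by auto
  then show ?thesis
    unfolding ent_def using assms by (auto intro!: sum.mono_neutral_left)
qed

context prob_space
begin

lemma ent_eq_entropy: "simple_function M X \<Longrightarrow> ent M X = entropy (exp 1) (count_space (X ` space M)) X"
proof -
  assume X: "simple_function M X"
  interpret information_space M "exp 1"
    by unfold_locales simp
  show ?thesis
    by (simp add: entropy_simple_distributed[OF simple_distributedI[OF X measure_nonneg refl]] ent_def log_def)
qed

text \<open>Grouping the values of \<open>W\<close> by their image under \<open>f\<close> puts the
  entropies of all functions of \<open>W\<close> over one index set, where they can be compared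
  termwise.\<close>

lemma ent_compose_eq:
  assumes W: "simple_function M W"
  shows "ent M (\<lambda>x. f (W x)) = - (\<Sum>w\<in>W ` space M. prob (W -` {w} \<inter> space M) *
    ln (prob ((\<lambda>x. f (W x)) -` {f w} \<inter> space M)))"
proof -
  let ?p = "\<lambda>w. prob (W -` {w} \<inter> space M)" and ?q = "\<lambda>v. prob ((\<lambda>x. f (W x)) -` {v} \<inter> space M)"
  let ?I = "W ` space M"
  have fin: "finite ?I" using W by (rule simple_functionD)
  have q: "?q v = (\<Sum>w\<in>{w\<in>?I. f w = v}. ?p w)" for v
  proof -
    have "(\<lambda>x. f (W x)) -` {v} \<inter> space M = (\<Union>w\<in>{w\<in>?I. f w = v}. W -` {w} \<inter> space M)" by auto
    also have "prob \<dots> = (\<Sum>w\<in>{w\<in>?I. f w = v}. ?p w)"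
      by (rule finite_measure_finite_Union)
         (use fin simple_functionD(2)[OF W] in \<open>auto simp: disjoint_family_on_def\<close>)
    finally show ?thesis .
  qed
  have "(\<Sum>w\<in>?I. ?p w * ln (?q (f w))) = (\<Sum>v\<in>f ` ?I. \<Sum>w\<in>{w\<in>?I. f w = v}. ?p w * ln (?q (f w)))"
    using fin by (rule sum.image_gen)
  also have "\<dots> = (\<Sum>v\<in>f ` ?I. ?q v * ln (?q v))"
    by (intro sum.cong refl) (simp add: q sum_distrib_right)
  finally show ?thesis by (simp add: ent_def image_image)
qed

text \<open>This is the nonnegativity of the conditional mutual information of \<open>X\<close> and
  \<open>Y\<close> given \<open>Z\<close>, expanded into four entropies.\<close>

lemma ent_strong_subadditive:
  assumes X: "simple_function M X" and Y: "simple_function M Y" and Z: "simple_function M Z"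
  shows "ent M (\<lambda>x. (X x, Y x, Z x)) + ent M Z \<le> ent M (\<lambda>x. (X x, Z x)) + ent M (\<lambda>x. (Y x, Z x))"
proof -
  interpret information_space M "exp 1"
    by unfold_locales simp
  let ?W = "\<lambda>x. (X x, Y x, Z x)"
  have W: "simple_function M ?W" and YZ: "simple_function M (\<lambda>x. (Y x, Z x))"
    and XZ: "simple_function M (\<lambda>x. (X x, Z x))"
    using X Y Z by (auto intro!: simple_function_Pair)
  let ?p = "\<lambda>w. prob (?W -` {w} \<inter> space M)"
  let ?z = "\<lambda>z. prob (Z -` {z} \<inter> space M)"
  let ?yz = "\<lambda>v. prob ((\<lambda>x. (Y x, Z x)) -` {v} \<inter> space M)"
  let ?xz = "\<lambda>v. prob ((\<lambda>x. (X x, Z x)) -` {v} \<inter> space M)"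
  let ?I = "?W ` space M"
  have 0: "ent M ?W = - (\<Sum>w\<in>?I. ?p w * ln (?p w))" by (simp add: ent_def)
  have 1: "ent M Z = - (\<Sum>w\<in>?I. ?p w * ln (?z (snd (snd w))))"
    using ent_compose_eq[OF W, of "\<lambda>w. snd (snd w)"] by simp
  have 2: "ent M (\<lambda>x. (Y x, Z x)) = - (\<Sum>w\<in>?I. ?p w * ln (?yz (snd w)))"
    using ent_compose_eq[OF W, of snd] by simp
  have 3: "ent M (\<lambda>x. (X x, Z x)) = - (\<Sum>w\<in>?I. ?p w * ln (?xz (fst w, snd (snd w))))"
    using ent_compose_eq[OF W, of "\<lambda>w. (fst w, snd (snd w))"] by simp
  note d = simple_distributedI[OF _ measure_nonneg refl]
  have "0 \<le> conditional_mutual_information (exp 1) (count_space (X ` space M)) (count_space (Y ` space M))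
     (count_space (Z ` space M)) X Y Z"
    by (rule conditional_mutual_information_nonneg[OF X Y Z])
  also have "\<dots> = (\<Sum>(x, y, z)\<in>?I. ?p (x, y, z) * log (exp 1) (?p (x, y, z) / (?xz (x, z) * (?yz (y, z) / ?z z))))"
    by (rule conditional_mutual_information_eq[OF d[OF Z] d[OF YZ] d[OF XZ] d[OF W]])
  also have "\<dots> = (\<Sum>w\<in>?I. ?p w * ln (?p w) + ?p w * ln (?z (snd (snd w)))
       - ?p w * ln (?xz (fst w, snd (snd w))) - ?p w * ln (?yz (snd w)))"
  proof (intro sum.cong refl, clarify)
    fix x assume x: "x \<in> space M"
    let ?w = "(X x, Y x, Z x)"
    show "?p ?w * log (exp 1) (?p ?w / (?xz (X x, Z x) * (?yz (Y x, Z x) / ?z (Z x)))) =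
       ?p ?w * ln (?p ?w) + ?p ?w * ln (?z (snd (snd ?w))) -
       ?p ?w * ln (?xz (fst ?w, snd (snd ?w))) - ?p ?w * ln (?yz (snd ?w))"
    \<comment> \<open>Null atoms contribute zero on both sides. Any other atom lies inside its three
      marginal fibres, so all masses are positive and the logarithm of the quotient splits.\<close>
    proof (cases "?p ?w = 0")
      case False
      then have p: "0 < ?p ?w" by (simp add: zero_less_measure_iff)
      have le: "?p ?w \<le> ?z (Z x)" "?p ?w \<le> ?xz (X x, Z x)" "?p ?w \<le> ?yz (Y x, Z x)"
        by (auto intro!: finite_measure_mono simple_functionD(2) XZ YZ Z)
      then have "0 < ?z (Z x)" "0 < ?xz (X x, Z x)" "0 < ?yz (Y x, Z x)" using p by linarith+
      with p show ?thesis by (simp add: log_def ln_div ln_mult algebra_simps)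
    qed simp
  qed
  finally show ?thesis
    unfolding 0 1 2 3 by (simp add: sum.distrib sum_subtractf)
qed

text \<open>On \<open>space M\<close>, \<open>X\<close> factors through \<open>Y\<close>: evaluating
  \<open>X\<close> at a chosen point of each fibre of \<open>Y\<close> gives the factor map, and the
  data processing inequality applies.\<close>

lemma ent_mono:
  assumes Y: "simple_function M Y"
    and det: "\<And>x y. x \<in> space M \<Longrightarrow> y \<in> space M \<Longrightarrow> Y x = Y y \<Longrightarrow> X x = X y"
  shows "ent M X \<le> ent M Y"
proof -
  interpret information_space M "exp 1"
    by unfold_locales simp
  define f where "f v = X (SOME y. y \<in> space M \<and> Y y = v)" for v
  have eq: "X x = (f \<circ> Y) x" if "x \<in> space M" for x
  proof -
    have "(SOME y. y \<in> space M \<and> Y y = Y x) \<in> space M \<and> Y (SOME y. y \<in> space M \<and> Y y = Y x) = Y x"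
      by (rule someI[of _ x]) (use that in simp)
    then show ?thesis using det[OF that] by (simp add: f_def)
  qed
  have fY: "simple_function M (f \<circ> Y)" using Y by (rule simple_function_compose)
  have "X -` {v} \<inter> space M = (f \<circ> Y) -` {v} \<inter> space M" for v using eq by auto
  moreover have "X ` space M = (f \<circ> Y) ` space M" using eq by (rule image_cong[OF refl])
  ultimately have "ent M X = ent M (f \<circ> Y)" by (simp only: ent_def)
  also have "\<dots> \<le> ent M Y"
    using entropy_data_processing[OF Y, of f] ent_eq_entropy[OF Y] ent_eq_entropy[OF fY] by simp
  finally show ?thesis .
qed

lemma ent_cong_det:
  assumes "simple_function M X" "simple_function M Y"
    and "\<And>x y. x \<in> space M \<Longrightarrow> y \<in> space M \<Longrightarrow> X x = X y \<longleftrightarrow> Y x = Y y"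
  shows "ent M X = ent M Y"
  using assms by (intro antisym ent_mono) auto

lemma ent_nonneg: "simple_function M X \<Longrightarrow> 0 \<le> ent M X"
  using ent_mono[of X "\<lambda>_. ()"] by (simp add: ent_def image_constant_conv prob_space)

lemma ent_const [simp]: "ent M (\<lambda>_. c) = 0"
  by (simp add: ent_def image_constant_conv vimage_def not_empty prob_space)

lemma cond_ent_nonneg:
  "simple_function M X \<Longrightarrow> simple_function M Y \<Longrightarrow> 0 \<le> cond_ent M X Y"
  unfolding cond_ent_def by (simp, rule ent_mono) (auto intro: simple_function_Pair)

lemma cond_ent_le_ent:
  assumes X: "simple_function M X" and Y: "simple_function M Y"
  shows "cond_ent M X Y \<le> ent M X"
proof -
  have c: "simple_function M (\<lambda>_. ())" by simp
  have eqs: "ent M (\<lambda>x. (X x, Y x, ())) = ent M (\<lambda>x. (X x, Y x))"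
      "ent M (\<lambda>x. (X x, ())) = ent M X" "ent M (\<lambda>x. (Y x, ())) = ent M Y"
    using assms by (auto intro!: ent_cong_det simple_function_Pair)
  then show ?thesis
    using ent_strong_subadditive[OF X Y c] by (simp add: cond_ent_def)
qed

text \<open>Adjoining \<open>Z\<close> to \<open>Y\<close> does not refine its fibres, so strong
  subadditivity for the triple reduces to this inequality.\<close>

lemma cond_ent_antimono:
  assumes X: "simple_function M X" and Y: "simple_function M Y" and Z: "simple_function M Z"
    and det: "\<And>x y. x \<in> space M \<Longrightarrow> y \<in> space M \<Longrightarrow> Y x = Y y \<Longrightarrow> Z x = Z y"
  shows "cond_ent M X Y \<le> cond_ent M X Z"
proof -
  have eqs: "ent M (\<lambda>x. (X x, Y x, Z x)) = ent M (\<lambda>x. (X x, Y x))"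
      "ent M (\<lambda>x. (Y x, Z x)) = ent M Y"
    by (intro ent_cong_det simple_function_Pair X Y Z; use det in blast)+
  then show ?thesis
    using ent_strong_subadditive[OF X Y Z] by (simp add: cond_ent_def)
qed

lemma cond_ent_mono:
  assumes "simple_function M X" and "simple_function M Y"
    and "\<And>x y. x \<in> space M \<Longrightarrow> y \<in> space M \<Longrightarrow> X x = X y \<Longrightarrow> X' x = X' y"
  shows "cond_ent M X' Y \<le> cond_ent M X Y"
  unfolding cond_ent_def
  by (intro diff_right_mono ent_mono simple_function_Pair assms(1,2)) (use assms(3) in blast)

lemma cond_ent_Pair_le:
  assumes X: "simple_function M X" and Y: "simple_function M Y" and Z: "simple_function M Z"
  shows "cond_ent M (\<lambda>x. (X x, Y x)) Z \<le> cond_ent M X Z + cond_ent M Y Z"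
proof -
  have "ent M (\<lambda>x. ((X x, Y x), Z x)) = ent M (\<lambda>x. (X x, Y x, Z x))"
    using assms by (auto intro!: ent_cong_det simple_function_Pair)
  then show ?thesis
    using ent_strong_subadditive[OF X Y Z] by (simp add: cond_ent_def)
qed

text \<open>Simplicity and the bound are proved together because each induction step for the bound
  needs the shorter list to be simple.\<close>

lemma cond_ent_list_le:
  fixes X :: "nat \<Rightarrow> 'a \<Rightarrow> 'b"
  assumes "\<And>i. i < n \<Longrightarrow> simple_function M (X i)" and Z: "simple_function M Z"
  shows "simple_function M (\<lambda>x. map (\<lambda>i. X i x) [0..<n]) \<and>
    cond_ent M (\<lambda>x. map (\<lambda>i. X i x) [0..<n]) Z \<le> (\<Sum>i<n. cond_ent M (X i) Z)"
  using assms(1)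
proof (induction n)
  case 0
  have "ent M (\<lambda>x. ([] :: 'b list, Z x)) = ent M Z"
    using Z by (auto intro!: ent_cong_det simple_function_Pair)
  then show ?case by (simp add: cond_ent_def)
next
  case (Suc n)
  let ?L = "\<lambda>x. map (\<lambda>i. X i x) [0..<n]"
  have L: "simple_function M ?L" and le: "cond_ent M ?L Z \<le> (\<Sum>i<n. cond_ent M (X i) Z)"
    using Suc by auto
  have Xn: "simple_function M (X n)" using Suc by simp
  note LX = simple_function_Pair[OF L Xn]
  have eq: "(\<lambda>x. map (\<lambda>i. X i x) [0..<Suc n]) = (\<lambda>(l, v). l @ [v]) \<circ> (\<lambda>x. (?L x, X n x))"
    by auto
  have "simple_function M (\<lambda>x. map (\<lambda>i. X i x) [0..<Suc n])"
    unfolding eq using LX by (rule simple_function_compose)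
  moreover have "cond_ent M (\<lambda>x. map (\<lambda>i. X i x) [0..<Suc n]) Z \<le> cond_ent M (\<lambda>x. (?L x, X n x)) Z"
    by (rule cond_ent_mono[OF LX Z]) auto
  ultimately show ?case
    using cond_ent_Pair_le[OF L Xn Z] le by simp
qed

lemmas simple_function_list = cond_ent_list_le[THEN conjunct1, OF _ simple_function_const]

lemma ent_cong_AE:
  assumes X: "simple_function M X" and Y: "simple_function M Y" and "AE x in M. X x = Y x"
  shows "ent M X = ent M Y"
proof -
  let ?V = "X ` space M \<union> Y ` space M"
  have "finite ?V" using X Y by (auto dest: simple_functionD)
  moreover have "prob (X -` {v} \<inter> space M) = prob (Y -` {v} \<inter> space M)" for v
    using assms(3) by (intro finite_measure_eq_AE simple_functionD X Y) auto
  ultimately show ?thesis by (simp add: ent_eq_sum_superset[of ?V])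
qed

lemma ent_compose_invariant:
  assumes X: "simple_function M X" and inv: "invariant_measure M T"
  shows "ent M (\<lambda>x. X (T x)) = ent M X"
proof -
  have T: "T \<in> M \<rightarrow>\<^sub>M M" and d: "distr M M T = M" using inv by (auto simp: invariant_measure_def)
  have "prob ((\<lambda>x. X (T x)) -` {v} \<inter> space M) = prob (X -` {v} \<inter> space M)" for v
  proof -
    have "prob (X -` {v} \<inter> space M) = measure (distr M M T) (X -` {v} \<inter> space M)" by (simp add: d)
    also have "\<dots> = prob (T -` (X -` {v} \<inter> space M) \<inter> space M)"
      using T simple_functionD(2)[OF X] by (rule measure_distr)
    also have "T -` (X -` {v} \<inter> space M) \<inter> space M = (\<lambda>x. X (T x)) -` {v} \<inter> space M"
      using measurable_space[OF T] by auto
    finally show ?thesis ..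
  qed
  moreover have "(\<lambda>x. X (T x)) ` space M \<subseteq> X ` space M" using measurable_space[OF T] by auto
  ultimately show ?thesis
    using simple_functionD(1)[OF X] by (simp add: ent_eq_sum_superset[of "X ` space M"])
qed

lemma cond_ent_compose_invariant:
  assumes X: "simple_function M X" and Y: "simple_function M Y" and inv: "invariant_measure M T"
  shows "cond_ent M (\<lambda>x. X (T x)) (\<lambda>x. Y (T x)) = cond_ent M X Y"
  using ent_compose_invariant[OF simple_function_Pair[OF X Y] inv] ent_compose_invariant[OF Y inv]
  by (simp add: cond_ent_def)

lemma invariant_measure_funpow: "invariant_measure M T \<Longrightarrow> invariant_measure M (T ^^ n)"
proof (induction n)
  case 0
  show ?case by (simp add: invariant_measure_def distr_id2)
next
  case (Suc n)
  then have "distr M M (T \<circ> (T ^^ n)) = M"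
    using distr_distr[of T M M "T ^^ n" M] by (auto simp: invariant_measure_def)
  with Suc show ?case
    by (auto simp: invariant_measure_def comp_def intro: measurable_comp)
qed

lemma simple_function_compose_measurable:
  assumes "simple_function M X" "T \<in> M \<rightarrow>\<^sub>M M"
  shows "simple_function M (\<lambda>x. X (T x))"
  using assms(1) unfolding simple_function_def
proof safe
  assume fin: "finite (X ` space M)"
  show "finite ((\<lambda>x. X (T x)) ` space M)"
    by (rule finite_subset[OF _ fin]) (use measurable_space[OF assms(2)] in auto)
  fix x assume "\<forall>x\<in>X ` space M. X -` {x} \<inter> space M \<in> sets M" "x \<in> space M"
  then have "T -` (X -` {X (T x)} \<inter> space M) \<inter> space M \<in> sets M"
    using measurable_space[OF assms(2)] by (intro measurable_sets[OF assms(2)]) auto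
  also have "T -` (X -` {X (T x)} \<inter> space M) \<inter> space M = (\<lambda>x. X (T x)) -` {X (T x)} \<inter> space M"
    using measurable_space[OF assms(2)] by auto
  finally show "(\<lambda>x. X (T x)) -` {X (T x)} \<inter> space M \<in> sets M" .
qed

end

subsection \<open>Entropy rates and their comparison for commuting maps\<close>

text \<open>Fekete's lemma: the limit is the infimum of \<open>f n / n\<close> over positive
  \<open>n\<close>, which also gives the linear lower bound. The upper bound comes from division
  with remainder by a nearly optimal \<open>m\<close>.\<close>

lemma fekete:
  fixes f :: "nat \<Rightarrow> real"
  assumes nonneg: "\<And>n. 0 \<le> f n" and sub: "\<And>m n. f (m + n) \<le> f m + f n"
  obtains h where "(\<lambda>n. f n / real n) \<longlonglongrightarrow> h" "\<And>n. real n * h \<le> f n"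
proof
  define h where "h = (INF n\<in>{1..}. f n / real n)"
  have bdd: "bdd_below ((\<lambda>n. f n / real n) ` {1..})"
    by (rule bdd_belowI2[of _ 0]) (simp add: nonneg)
  have low: "h \<le> f n / real n" if "n \<ge> 1" for n
    unfolding h_def by (rule cINF_lower[OF bdd]) (use that in simp)
  have h0: "0 \<le> h" unfolding h_def by (rule cINF_greatest) (auto simp: nonneg)
  show "real n * h \<le> f n" for n
    using low[of n] nonneg[of 0] by (cases "n = 0") (auto simp: field_simps)
  show "(\<lambda>n. f n / real n) \<longlonglongrightarrow> h"
  proof (rule LIMSEQ_I)
    fix e :: real assume e: "0 < e"
    have "\<exists>m\<in>{1..}. f m / real m < h + e / 2"
      unfolding h_def[symmetric] using cINF_less_iff[OF _ bdd, of "h + e / 2"] e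
      by (auto simp: h_def)
    then obtain m where m: "m \<ge> 1" "f m / real m < h + e / 2" by auto
    \<comment> \<open>Dominates every remainder term \<open>f (n mod m)\<close> at once,
      independently of \<open>n\<close>.\<close>
    define C where "C = (\<Sum>r<m. f r)"
    have mult: "f (q * m + r) \<le> real q * f m + f r" for q r
    proof (induction q)
      case (Suc q)
      have "f (Suc q * m + r) \<le> f m + f (q * m + r)"
        using sub[of m "q * m + r"] by (simp add: add.assoc)
      then show ?case using Suc by (simp add: algebra_simps)
    qed simp
    have fm: "f m \<le> (h + e / 2) * real m" using m by (simp add: field_simps)
    have up: "f n \<le> (h + e / 2) * real n + C" for n
    proof -
      let ?q = "n div m" and ?r = "n mod m"
      have "f n \<le> real ?q * f m + f ?r" using mult[of ?q ?r] by simp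
      also have "f ?r \<le> C"
        unfolding C_def using m by (intro member_le_sum) (auto simp: nonneg)
      also have "real ?q * f m \<le> real ?q * ((h + e / 2) * real m)"
        using fm by (rule mult_left_mono) simp
      also have "\<dots> = (h + e / 2) * real (?q * m)" by simp
      also have "\<dots> \<le> (h + e / 2) * real n"
        using h0 e by (intro mult_left_mono) (simp_all del: of_nat_mult)
      finally show ?thesis by simp
    qed
    obtain N where N: "C / (e / 2) < real N" using reals_Archimedean2 by blast
    have "norm (f n / real n - h) < e" if n: "n \<ge> Suc N" for n
    proof -
      have n0: "real n > 0" using n by simp
      have "C < e / 2 * real N" using N e by (simp add: field_simps)
      also have "\<dots> \<le> e / 2 * real n" using n e by simp
      finally have "f n < (h + e) * real n" using up[of n] by (simp add: algebra_simps)
      then have "f n / real n < h + e" using n0 by (simp add: field_simps)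
      then show ?thesis using low[of n] n by (simp add: abs_if)
    qed
    then show "\<exists>no. \<forall>n\<ge>no. norm (f n / real n - h) < e" by blast
  qed
qed

text \<open>The fibres of \<open>itinerary T X n\<close> are the atoms of the join of the first
  \<open>n\<close> pullbacks of the fibre partition of \<open>X\<close>; lists replace partitions
  from here on.\<close>

definition itinerary :: "('x \<Rightarrow> 'x) \<Rightarrow> ('x \<Rightarrow> 'b) \<Rightarrow> nat \<Rightarrow> 'x \<Rightarrow> 'b list" where
  "itinerary T X n x = map (\<lambda>i. X ((T ^^ i) x)) [0..<n]"

lemma itinerary_Suc: "itinerary T X (Suc n) x = X x # itinerary T X n (T x)"
  unfolding itinerary_def upt_conv_Cons[OF zero_less_Suc] map_Suc_upt[symmetric]
  by (simp add: funpow_swap1)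

lemma itinerary_eq_iff:
  "itinerary T X n x = itinerary T X n y \<longleftrightarrow> (\<forall>i<n. X ((T ^^ i) x) = X ((T ^^ i) y))"
  by (auto simp: itinerary_def)

lemma funpow_commute:
  assumes "\<And>x. S (T x) = T (S x)"
  shows "(S ^^ m) ((T ^^ n) x) = (T ^^ n) ((S ^^ m) x)"
proof (induction m)
  case (Suc m)
  have "S ((T ^^ n) y) = (T ^^ n) (S y)" for y
    by (induction n) (simp_all add: assms)
  with Suc show ?case by simp
qed simp

context prob_space
begin

lemma invariant_measurable: "invariant_measure M T \<Longrightarrow> (T ^^ n) \<in> M \<rightarrow>\<^sub>M M"
  using invariant_measure_funpow by (auto simp: invariant_measure_def)

lemma simple_function_funpow:
  "simple_function M X \<Longrightarrow> invariant_measure M T \<Longrightarrow> simple_function M (\<lambda>x. X ((T ^^ n) x))"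
  by (rule simple_function_compose_measurable) (auto intro: invariant_measurable)

lemma simple_function_itinerary:
  assumes "simple_function M X" "invariant_measure M T"
  shows "simple_function M (itinerary T X n)"
  unfolding itinerary_def[abs_def]
  by (rule simple_function_list) (rule simple_function_funpow[OF assms])

lemma ent_itinerary_subadditive:
  assumes X: "simple_function M X" and T: "invariant_measure M T"
  shows "ent M (itinerary T X (m + n)) \<le> ent M (itinerary T X m) + ent M (itinerary T X n)"
proof -
  let ?A = "itinerary T X m" and ?B = "\<lambda>x. itinerary T X n ((T ^^ m) x)"
  note A = simple_function_itinerary[OF X T, of m]
  note B = simple_function_compose_measurable[OF simple_function_itinerary[OF X T, of n]
      invariant_measurable[OF T, of m]]
  have shift: "(\<forall>i<m + n. P i) \<longleftrightarrow> (\<forall>i<m. P i) \<and> (\<forall>i<n. P (i + m))" for P :: "nat \<Rightarrow> bool"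
    by (metis add.commute add_diff_inverse_nat less_diff_conv2 linorder_not_less nat_add_left_cancel_less trans_less_add1)
  have "ent M (itinerary T X (m + n)) \<le> ent M (\<lambda>x. (?B x, ?A x))"
    by (intro ent_mono simple_function_Pair A B)
       (simp add: itinerary_eq_iff shift funpow_add)
  also have "\<dots> \<le> ent M ?A + ent M ?B"
    using cond_ent_le_ent[OF B A] by (simp add: cond_ent_def)
  also have "ent M ?B = ent M (itinerary T X n)"
    by (rule ent_compose_invariant[OF simple_function_itinerary[OF X T] invariant_measure_funpow[OF T]])
  finally show ?thesis .
qed

lemma ent_rate_obtain:
  assumes X: "simple_function M X" and T: "invariant_measure M T"
  obtains h where "(\<lambda>n. ent M (itinerary T X n) / real n) \<longlonglongrightarrow> h"
    "\<And>n. real n * h \<le> ent M (itinerary T X n)"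
  using fekete[of "\<lambda>n. ent M (itinerary T X n)"]
    ent_nonneg[OF simple_function_itinerary[OF X T]] ent_itinerary_subadditive[OF X T]
  by blast

lemma cond_ent_itinerary_le:
  assumes X: "simple_function M X" and T: "invariant_measure M T" and Z: "simple_function M Z"
  shows "cond_ent M (itinerary T X n) Z \<le> (\<Sum>i<n. cond_ent M (\<lambda>x. X ((T ^^ i) x)) Z)"
  unfolding itinerary_def[abs_def]
  by (rule cond_ent_list_le[THEN conjunct2, OF simple_function_funpow[OF X T] Z])

text \<open>As the maps commute, the \<open>S\<close>-itinerary of \<open>T\<close>-itineraries is
  an array of symbols that can be read the other way, as \<open>n\<close> translates of
  \<open>itinerary S Y m\<close>. By invariance under \<open>T\<close> each translate has the same
  entropy, so the rate grows at most by the factor \<open>n\<close>.\<close>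

lemma zero_rate_itinerary:
  assumes S: "invariant_measure M S" and T: "invariant_measure M T"
    and comm: "\<And>x. S (T x) = T (S x)"
    and Y: "simple_function M Y"
    and zero: "(\<lambda>m. ent M (itinerary S Y m) / real m) \<longlonglongrightarrow> 0"
  shows "(\<lambda>m. ent M (itinerary S (itinerary T Y n) m) / real m) \<longlonglongrightarrow> 0"
proof (rule tendsto_sandwich[OF _ _ tendsto_const])
  let ?W = "itinerary T Y n"
  note W = simple_function_itinerary[OF Y T, of n]
  show "\<forall>\<^sub>F m in sequentially. 0 \<le> ent M (itinerary S ?W m) / real m"
    by (intro always_eventually allI divide_nonneg_nonneg ent_nonneg simple_function_itinerary W S) simp
  have le: "ent M (itinerary S ?W m) \<le> real n * ent M (itinerary S Y m)" for m
  proof -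
    have c: "simple_function M (\<lambda>_. ())" by simp
    have J: "simple_function M (\<lambda>x. itinerary S Y m ((T ^^ i) x))" for i
      by (rule simple_function_funpow[OF simple_function_itinerary[OF Y S] T])
    let ?L = "\<lambda>x. map (\<lambda>i. itinerary S Y m ((T ^^ i) x)) [0..<n]"
    have L: "simple_function M ?L" by (rule simple_function_list[OF J])
    have [simp]: "cond_ent M X (\<lambda>_. ()) = ent M X" if "simple_function M X" for X :: "'a \<Rightarrow> 'd"
      using that by (auto simp: cond_ent_def intro!: ent_cong_det simple_function_Pair)
    have "ent M (itinerary S ?W m) \<le> ent M ?L"
      by (intro ent_mono L) (simp add: itinerary_eq_iff funpow_commute[where S = S and T = T, OF comm])
    also have "\<dots> \<le> (\<Sum>i<n. ent M (\<lambda>x. itinerary S Y m ((T ^^ i) x)))"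
      using cond_ent_list_le[where n = n and X = "\<lambda>i x. itinerary S Y m ((T ^^ i) x)", OF J c] J L by simp
    also have "\<dots> = (\<Sum>i<n. ent M (itinerary S Y m))"
      by (intro sum.cong refl ent_compose_invariant simple_function_itinerary Y S invariant_measure_funpow T)
    finally show ?thesis by simp
  qed
  show "\<forall>\<^sub>F m in sequentially. ent M (itinerary S ?W m) / real m \<le> real n * (ent M (itinerary S Y m) / real m)"
    using le by (intro always_eventually allI) (simp add: divide_right_mono)
  show "(\<lambda>m. real n * (ent M (itinerary S Y m) / real m)) \<longlonglongrightarrow> 0"
    using tendsto_mult_right_zero[OF zero] .
qed

text \<open>Cut the first \<open>n m\<close> symbols of the \<open>X\<close>-itinerary into \<open>m\<close> blocks of length \<open>n\<close> and condition the
  \<open>k\<close>-th block on \<open>Z \<circ> S\<^sup>k\<^sup>n\<close> only.\<close>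

lemma zero_rate_cond_ent_ge:
  assumes S: "invariant_measure M S" and X: "simple_function M X" and Z: "simple_function M Z"
    and h: "\<And>n. real n * h \<le> ent M (itinerary S X n)"
    and zero: "(\<lambda>m. ent M (itinerary S Z m) / real m) \<longlonglongrightarrow> 0"
  shows "real n * h \<le> cond_ent M (itinerary S X n) Z"
proof (cases "n = 0")
  case True
  then show ?thesis using cond_ent_nonneg[OF simple_function_itinerary[OF X S] Z] by simp
next
  case False
  let ?A = "itinerary S X n"
  note A = simple_function_itinerary[OF X S]
  note IZ = simple_function_itinerary[OF Z S]
  have le: "real m * (real n * h) \<le> ent M (itinerary S Z (n * m)) + real m * cond_ent M ?A Z" for m
  proof -
    let ?Z = "itinerary S Z (n * m)"
    let ?L = "\<lambda>x. map (\<lambda>k. ?A ((S ^^ (n * k)) x)) [0..<m]"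
    have AS: "simple_function M (\<lambda>x. ?A ((S ^^ (n * k)) x))" for k
      by (rule simple_function_funpow[OF A S])
    have L: "simple_function M ?L" by (rule simple_function_list[OF AS])
    have "real m * (real n * h) \<le> ent M (itinerary S X (n * m))"
      using h[of "n * m"] by (simp add: ac_simps)
    also have "\<dots> \<le> ent M ?L"
    proof (rule ent_mono[OF L])
      fix x y assume "?L x = ?L y"
      then have eq: "X ((S ^^ i) ((S ^^ (n * k)) x)) = X ((S ^^ i) ((S ^^ (n * k)) y))"
        if "k < m" "i < n" for k i
        using that by (auto simp: itinerary_eq_iff)
      have "X ((S ^^ i) x) = X ((S ^^ i) y)" if "i < n * m" for i
      proof -
        \<comment> \<open>Position \<open>i\<close> sits in block \<open>i div n\<close> at offset
          \<open>i mod n\<close>.\<close>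
        have "i div n < m" using that by (simp add: less_mult_imp_div_less mult.commute)
        then show ?thesis
          using eq[of "i div n" "i mod n"] \<open>n \<noteq> 0\<close>
          by (simp add: comp_apply[symmetric, of "S ^^ _" "S ^^ _"] funpow_add[symmetric] del: comp_apply)
      qed
      then show "itinerary S X (n * m) x = itinerary S X (n * m) y" by (simp add: itinerary_eq_iff)
    qed
    also have "\<dots> \<le> ent M (\<lambda>x. (?L x, ?Z x))"
      by (intro ent_mono simple_function_Pair L IZ) simp
    also have "\<dots> = ent M ?Z + cond_ent M ?L ?Z" by (simp add: cond_ent_def)
    also have "cond_ent M ?L ?Z \<le> (\<Sum>k<m. cond_ent M (\<lambda>x. ?A ((S ^^ (n * k)) x)) ?Z)"
      by (rule cond_ent_list_le[THEN conjunct2, OF AS IZ])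
    also have "\<dots> \<le> (\<Sum>k<m. cond_ent M (\<lambda>x. ?A ((S ^^ (n * k)) x)) (\<lambda>x. Z ((S ^^ (n * k)) x)))"
    proof (intro sum_mono cond_ent_antimono AS IZ simple_function_funpow[OF Z S])
      fix k x y assume "k \<in> {..<m}" and eq: "?Z x = ?Z y"
      then have "n * k < n * m" using \<open>n \<noteq> 0\<close> by simp
      with eq show "Z ((S ^^ (n * k)) x) = Z ((S ^^ (n * k)) y)" by (simp add: itinerary_eq_iff)
    qed
    also have "\<dots> = real m * cond_ent M ?A Z"
      using cond_ent_compose_invariant[OF A Z invariant_measure_funpow[OF S]] by simp
    finally show ?thesis by simp
  qed
  \<comment> \<open>After division by \<open>m\<close>, the entropy of the
    \<open>Z\<close>-itinerary disappears along the multiples of \<open>n\<close>; the factor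
    \<open>real n\<close> compensates for dividing by \<open>n * m\<close>.\<close>
  have lim: "(\<lambda>m. real n * (ent M (itinerary S Z (n * m)) / real (n * m)) + cond_ent M ?A Z)
     \<longlonglongrightarrow> real n * 0 + cond_ent M ?A Z"
    using LIMSEQ_subseq_LIMSEQ[OF zero, of "\<lambda>m. n * m"] \<open>n \<noteq> 0\<close>
    by (intro tendsto_add tendsto_mult tendsto_const) (simp_all add: strict_mono_def comp_def)
  have "real n * h \<le> real n * 0 + cond_ent M ?A Z"
  proof (rule LIMSEQ_le_const[OF lim], intro exI[of _ 1] allI impI)
    fix m :: nat assume "1 \<le> m"
    then show "real n * h \<le> real n * (ent M (itinerary S Z (n * m)) / real (n * m)) + cond_ent M ?A Z"
      using le[of m] \<open>n \<noteq> 0\<close> by (simp add: field_simps)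
  qed
  then show ?thesis by simp
qed

text \<open>Here \<open>same\<close> carries the lower bound for conditional entropies from
  \<open>S\<close>-itineraries of \<open>X\<close> to \<open>T\<close>-itineraries, while
  \<open>gen\<close> says that \<open>X\<close> generates \<open>Y\<close> under \<open>T\<close> up
  to small conditional entropy.\<close>

theorem zero_rate_transfer:
  assumes S: "invariant_measure M S" and T: "invariant_measure M T"
    and comm: "\<And>x. S (T x) = T (S x)"
    and X: "simple_function M X" and Y: "simple_function M Y"
    and same: "\<And>n x y. x \<in> space M \<Longrightarrow> y \<in> space M \<Longrightarrow>
      itinerary S X n x = itinerary S X n y \<longleftrightarrow> itinerary T X n x = itinerary T X n y"
    and gen: "\<And>e. e > 0 \<Longrightarrow> \<exists>k. cond_ent M Y (itinerary T X k) < e"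
    and zero: "(\<lambda>n. ent M (itinerary S Y n) / real n) \<longlonglongrightarrow> 0"
  shows "(\<lambda>n. ent M (itinerary T Y n) / real n) \<longlonglongrightarrow> 0"
proof (rule LIMSEQ_I)
  fix e :: real assume e: "0 < e"
  note XT = simple_function_itinerary[OF X T]
  note YT = simple_function_itinerary[OF Y T]
  note XS = simple_function_itinerary[OF X S]
  obtain h where lim: "(\<lambda>n. ent M (itinerary T X n) / real n) \<longlonglongrightarrow> h"
    and h: "\<And>n. real n * h \<le> ent M (itinerary T X n)"
    using ent_rate_obtain[OF X T] by blast
  \<comment> \<open>Equal fibres give equal entropies, so \<open>h\<close> bounds the
    \<open>S\<close>-itineraries as well.\<close>
  have ST: "ent M (itinerary S X n) = ent M (itinerary T X n)" for n
    by (intro ent_cong_det XS XT same)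
  obtain k where k: "cond_ent M Y (itinerary T X k) < e / 2" using gen[of "e / 2"] e by auto
  let ?c = "cond_ent M Y (itinerary T X k)"
  have le: "ent M (itinerary T Y n) \<le> ent M (itinerary T X (n + k)) - real n * h + real n * ?c" for n
  proof -
    have "real n * h \<le> cond_ent M (itinerary S X n) (itinerary T Y n)"
      using zero_rate_itinerary[OF S T comm Y zero]
      by (intro zero_rate_cond_ent_ge S X YT) (simp_all add: ST h)
    also have "\<dots> \<le> cond_ent M (itinerary T X n) (itinerary T Y n)"
      by (intro cond_ent_mono XT YT) (simp add: same)
    finally have "ent M (itinerary T Y n) \<le> ent M (\<lambda>x. (itinerary T X n x, itinerary T Y n x)) - real n * h"
      by (simp add: cond_ent_def)
    moreover have "ent M (\<lambda>x. (itinerary T X n x, itinerary T Y n x)) \<le>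
        ent M (\<lambda>x. (itinerary T Y n x, itinerary T X (n + k) x))"
      by (intro ent_mono simple_function_Pair XT YT) (auto simp: itinerary_eq_iff)
    \<comment> \<open>The \<open>k\<close> extra symbols make the window of length \<open>k\<close>
      starting at any \<open>i < n\<close> visible, and each such window costs at most
      \<open>?c\<close>.\<close>
    moreover have "cond_ent M (itinerary T Y n) (itinerary T X (n + k)) \<le> real n * ?c"
    proof -
      have "cond_ent M (itinerary T Y n) (itinerary T X (n + k)) \<le>
          (\<Sum>i<n. cond_ent M (\<lambda>x. Y ((T ^^ i) x)) (itinerary T X (n + k)))"
        by (rule cond_ent_itinerary_le[OF Y T XT])
      also have "\<dots> \<le> (\<Sum>i<n. cond_ent M (\<lambda>x. Y ((T ^^ i) x)) (\<lambda>x. itinerary T X k ((T ^^ i) x)))"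
      proof (intro sum_mono cond_ent_antimono simple_function_funpow[OF Y T] XT simple_function_funpow[OF XT T])
        fix i x y assume i: "i \<in> {..<n}" and eq: "itinerary T X (n + k) x = itinerary T X (n + k) y"
        have "X ((T ^^ j) ((T ^^ i) x)) = X ((T ^^ j) ((T ^^ i) y))" if "j < k" for j
        proof -
          have "j + i < n + k" using i that by simp
          then have "X ((T ^^ (j + i)) x) = X ((T ^^ (j + i)) y)"
            using eq by (simp add: itinerary_eq_iff)
          then show ?thesis by (simp add: funpow_add)
        qed
        then show "itinerary T X k ((T ^^ i) x) = itinerary T X k ((T ^^ i) y)"
          by (simp add: itinerary_eq_iff)
      qed
      also have "\<dots> = real n * ?c"
        using cond_ent_compose_invariant[OF Y XT invariant_measure_funpow[OF T]] by simp
      finally show ?thesis .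
    qed
    ultimately show ?thesis by (simp add: cond_ent_def)
  qed
  \<comment> \<open>The fixed number \<open>k\<close> of extra symbols does not change the rate
    \<open>h\<close>.\<close>
  have quot: "(\<lambda>n. real (n + k) / real n) \<longlonglongrightarrow> 1"
    by real_asymp
  have "(\<lambda>n. ent M (itinerary T X (n + k)) / real (n + k) * (real (n + k) / real n)) \<longlonglongrightarrow> h * 1"
    by (intro tendsto_mult quot LIMSEQ_ignore_initial_segment[OF lim])
  then have "\<forall>\<^sub>F n in sequentially. ent M (itinerary T X (n + k)) / real (n + k) * (real (n + k) / real n) < h + e / 2"
    using e by (intro order_tendstoD) auto
  moreover have "\<forall>\<^sub>F n in sequentially. 0 < n" by (rule eventually_gt_at_top)
  ultimately have "\<forall>\<^sub>F n in sequentially. norm (ent M (itinerary T Y n) / real n - 0) < e"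
  proof eventually_elim
    case (elim n)
    then have "ent M (itinerary T X (n + k)) / real n < h + e / 2" by simp
    then have "ent M (itinerary T X (n + k)) < (h + e / 2) * real n" using elim by (simp add: field_simps)
    moreover have "real n * ?c \<le> real n * (e / 2)" using k by (intro mult_left_mono) auto
    ultimately have "ent M (itinerary T Y n) < e * real n"
      using le[of n] by (simp add: algebra_simps)
    then show ?case using ent_nonneg[OF YT, of n] elim by (simp add: field_simps)
  qed
  then show "\<exists>no. \<forall>n\<ge>no. norm (ent M (itinerary T Y n) / real n - 0) < e"
    by (simp add: eventually_sequentially)
qed

end

subsection \<open>Kolmogorov--Sinai entropy of two-set partitions\<close>

text \<open>An empty atom contributes nothing, and the nonempty atoms correspond one to one to the
  values of \<open>X\<close>.\<close>

lemma partition_entropy_eq_ent: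
  assumes fin: "finite P" and X: "finite (X ` space M)"
    and P: "P - {{}} = (\<lambda>x. {y \<in> space M. X y = X x}) ` space M"
  shows "partition_entropy M P = ent M X"
proof -
  let ?F = "\<lambda>v. X -` {v} \<inter> space M"
  have P': "P - {{}} = ?F ` X ` space M" unfolding P by (auto simp: image_image intro!: image_eqI)
  have inj: "inj_on ?F (X ` space M)" by (rule inj_onI) blast
  have "(\<Sum>A\<in>P. measure M A * ln (measure M A)) = (\<Sum>A\<in>P - {{}}. measure M A * ln (measure M A))"
    using fin by (intro sum.mono_neutral_right) auto
  also have "\<dots> = (\<Sum>v\<in>X ` space M. measure M (?F v) * ln (measure M (?F v)))"
    unfolding P' using inj by (simp add: sum.reindex)
  finally show ?thesis by (simp add: partition_entropy_def ent_def)
qed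

text \<open>Intersections of atoms may be empty, hence only the nonempty members of the join are
  identified with fibres of the itinerary.\<close>

lemma iterated_join_eq_fibres:
  assumes T: "T \<in> space M \<rightarrow> space M" and A: "A \<subseteq> space M"
  defines "J \<equiv> iterated_join M T {A, space M - A}"
  shows "finite (J n) \<and>
    J n - {{}} = (\<lambda>x. {y \<in> space M. itinerary T (\<lambda>x. x \<in> A) n y = itinerary T (\<lambda>x. x \<in> A) n x}) ` space M"
proof (induction n)
  case 0
  show ?case by (auto simp: J_def itinerary_def)
next
  case (Suc n)
  let ?f = "itinerary T (\<lambda>x. x \<in> A)"
  let ?fib = "\<lambda>n x. {y \<in> space M. ?f n y = ?f n x}"
  let ?Q = "partition_preimage M (T ^^ n) {A, space M - A}"
  have Tn: "(T ^^ n) x \<in> space M" if "x \<in> space M" for x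
    using that T by (induction n) auto
  have J: "J (Suc n) = {B \<inter> C | B C. B \<in> J n \<and> C \<in> ?Q}" by (simp add: J_def partition_join_def)
  have Q: "?Q = {(T ^^ n) -` A \<inter> space M, (T ^^ n) -` (space M - A) \<inter> space M}"
    by (auto simp: partition_preimage_def)
  have "J (Suc n) = (\<lambda>(B, C). B \<inter> C) ` (J n \<times> ?Q)" unfolding J by auto
  then have fin: "finite (J (Suc n))" using Suc by (simp add: Q)
  have fS: "?f (Suc n) y = ?f (Suc n) x \<longleftrightarrow> ?f n y = ?f n x \<and> ((T ^^ n) y \<in> A \<longleftrightarrow> (T ^^ n) x \<in> A)" for x y
    by (auto simp: itinerary_eq_iff less_Suc_eq)
  have part: "C = {y \<in> space M. (T ^^ n) y \<in> A \<longleftrightarrow> (T ^^ n) x \<in> A}" if "C \<in> ?Q" "x \<in> C" for C x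
    using that Tn unfolding Q by auto
  have fibre: "B \<inter> C \<in> ?fib (Suc n) ` space M" if BC: "B \<in> J n" "C \<in> ?Q" and ne: "B \<inter> C \<noteq> {}" for B C
  proof -
    from ne obtain x where x: "x \<in> B" "x \<in> C" by auto
    have "B \<in> ?fib n ` space M" using Suc BC x by blast
    then have B: "B = ?fib n x" "x \<in> space M" using x by auto
    have "B \<inter> C = ?fib (Suc n) x" unfolding B(1) part[OF BC(2) x(2)] fS by auto
    then show ?thesis using B(2) by auto
  qed
  have "?fib (Suc n) x \<in> J (Suc n) - {{}}" if x: "x \<in> space M" for x
  proof -
    let ?C = "{y \<in> space M. (T ^^ n) y \<in> A \<longleftrightarrow> (T ^^ n) x \<in> A}"
    have "?fib n x \<in> J n" using Suc x by blast
    moreover have "?C \<in> ?Q" using Tn unfolding Q by (cases "(T ^^ n) x \<in> A") auto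
    moreover have "?fib (Suc n) x = ?fib n x \<inter> ?C" unfolding fS by auto
    ultimately have "?fib (Suc n) x \<in> J (Suc n)" unfolding J by blast
    then show ?thesis using x by auto
  qed
  then have "?fib (Suc n) ` space M \<subseteq> J (Suc n) - {{}}" by blast
  moreover have "J (Suc n) - {{}} \<subseteq> ?fib (Suc n) ` space M"
  proof
    fix D assume "D \<in> J (Suc n) - {{}}"
    then obtain B C where "D = B \<inter> C" "B \<in> J n" "C \<in> ?Q" "B \<inter> C \<noteq> {}" unfolding J by blast
    then show "D \<in> ?fib (Suc n) ` space M" using fibre by simp
  qed
  ultimately have "J (Suc n) - {{}} = ?fib (Suc n) ` space M" by (rule subset_antisym[rotated])
  with fin show ?case by blast
qed

context prob_space
begin

lemma simple_function_mem: "A \<in> sets M \<Longrightarrow> simple_function M (\<lambda>x. x \<in> A)"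
  unfolding simple_function_def
proof safe
  fix x assume A: "A \<in> sets M"
  show "(\<lambda>x. x \<in> A) -` {x \<in> A} \<inter> space M \<in> sets M"
  proof (cases "x \<in> A")
    case True
    then have "(\<lambda>x. x \<in> A) -` {x \<in> A} \<inter> space M = A" using sets.sets_into_space[OF A] by auto
    with A show ?thesis by simp
  next
    case False
    then have "(\<lambda>x. x \<in> A) -` {x \<in> A} \<inter> space M = space M - A" by auto
    with A show ?thesis by simp
  qed
qed (rule finite_subset[OF subset_UNIV finite])

lemma ks_entropy_eq_0_iff:
  assumes A: "A \<in> sets M" and T: "invariant_measure M T"
  shows "ks_entropy M T {A, space M - A} = 0 \<longleftrightarrow>
    (\<lambda>n. ent M (itinerary T (\<lambda>x. x \<in> A) n) / real n) \<longlonglongrightarrow> 0"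
proof -
  note XA = simple_function_mem[OF A]
  have "T \<in> space M \<rightarrow> space M"
    using T measurable_space[of T M M] by (auto simp: invariant_measure_def)
  note J = iterated_join_eq_fibres[OF this sets.sets_into_space[OF A]]
  have eq: "partition_entropy M (iterated_join M T {A, space M - A} n) = ent M (itinerary T (\<lambda>x. x \<in> A) n)" for n
    using J simple_functionD(1)[OF simple_function_itinerary[OF XA T]]
    by (intro partition_entropy_eq_ent) auto
  \<comment> \<open>\<open>lim\<close> has a meaning only for convergent sequences, so existence of
    the limit is needed before zero can be read off.\<close>
  obtain h where h: "(\<lambda>n. ent M (itinerary T (\<lambda>x. x \<in> A) n) / real n) \<longlonglongrightarrow> h"
    using ent_rate_obtain[OF XA T] by blast
  show ?thesis
    unfolding ks_entropy_def eq limI[OF h] using h by (blast intro: LIMSEQ_unique[OF h])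
qed

section \<open>Zero entropy and approximation by finite information\<close>

lemma ent_mem:
  assumes A: "A \<in> sets M"
  shows "ent M (\<lambda>x. x \<in> A) = - (prob A * ln (prob A) + (1 - prob A) * ln (1 - prob A))"
proof -
  have "(\<lambda>x. x \<in> A) -` {True} \<inter> space M = A" using sets.sets_into_space[OF A] by auto
  moreover have "(\<lambda>x. x \<in> A) -` {False} \<inter> space M = space M - A" by auto
  ultimately show ?thesis
    using ent_eq_sum_superset[of "UNIV :: bool set" "\<lambda>x. x \<in> A" M, OF finite subset_UNIV]
    by (simp add: UNIV_bool prob_compl[OF A])
qed

text \<open>Once \<open>U\<close> is known, \<open>E\<close> and its symmetric difference with
  \<open>U\<close> determine each other. A set of small probability has small entropy, as the binary
  entropy function tends to zero at 0.\<close>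

lemma cond_ent_approx:
  assumes E: "E \<in> sets M" and e: "0 < e"
    and ap: "\<And>d. 0 < d \<Longrightarrow> \<exists>k U. U \<in> sets M \<and> prob (sym_diff E U) < d \<and>
       (\<forall>x\<in>space M. \<forall>y\<in>space M. itinerary T X k x = itinerary T X k y \<longrightarrow> (x \<in> U \<longleftrightarrow> y \<in> U))"
    and X: "simple_function M X" and T: "invariant_measure M T"
  shows "\<exists>k. cond_ent M (\<lambda>x. x \<in> E) (itinerary T X k) < e"
proof -
  have "((\<lambda>p :: real. - (p * ln p + (1 - p) * ln (1 - p))) \<longlongrightarrow> 0) (at_right 0)"
    by real_asymp
  then have "\<forall>\<^sub>F p in at_right 0. - (p * ln p + (1 - p) * ln (1 - p)) < e"
    using e by (rule order_tendstoD)
  then obtain d :: real where d: "0 < d" "\<And>p. 0 < p \<Longrightarrow> p < d \<Longrightarrow> - (p * ln p + (1 - p) * ln (1 - p)) < e"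
    by (auto simp: eventually_at_right_field)
  from ap[OF d(1)] obtain k U where U: "U \<in> sets M" "prob (sym_diff E U) < d"
    and det: "\<And>x y. x \<in> space M \<Longrightarrow> y \<in> space M \<Longrightarrow> itinerary T X k x = itinerary T X k y \<Longrightarrow> (x \<in> U \<longleftrightarrow> y \<in> U)"
    by blast
  let ?D = "sym_diff E U"
  have D: "?D \<in> sets M" using E U by auto
  note sE = simple_function_mem[OF E] and sU = simple_function_mem[OF U(1)] and sD = simple_function_mem[OF D]
  have "cond_ent M (\<lambda>x. x \<in> E) (itinerary T X k) \<le> cond_ent M (\<lambda>x. x \<in> E) (\<lambda>x. x \<in> U)"
    by (rule cond_ent_antimono[OF sE simple_function_itinerary[OF X T] sU]) (use det in blast)
  also have "\<dots> = cond_ent M (\<lambda>x. x \<in> ?D) (\<lambda>x. x \<in> U)"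
    unfolding cond_ent_def
    by (intro arg_cong2[where f = "(-)"] ent_cong_det simple_function_Pair sE sU sD) auto
  also have "\<dots> \<le> ent M (\<lambda>x. x \<in> ?D)" by (rule cond_ent_le_ent[OF sD sU])
  also have "\<dots> < e"
    using d(2)[of "prob ?D"] U(2) e by (cases "prob ?D = 0") (simp_all add: ent_mem[OF D] zero_less_measure_iff del: Un_iff Diff_iff)
  finally show ?thesis by blast
qed

text \<open>By the chain rule and invariance, these conditional entropies are the increments of the
  itinerary entropies. If all were at least \<open>e\<close>, so would be the rate.\<close>

lemma zero_rate_cond_ent:
  assumes Y: "simple_function M Y" and T: "invariant_measure M T"
    and zero: "(\<lambda>n. ent M (itinerary T Y n) / real n) \<longlonglongrightarrow> 0" and e: "0 < e"
  shows "\<exists>n. cond_ent M Y (\<lambda>x. itinerary T Y n (T x)) < e"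
proof (rule ccontr)
  assume "\<nexists>n. cond_ent M Y (\<lambda>x. itinerary T Y n (T x)) < e"
  then have ge: "e \<le> cond_ent M Y (\<lambda>x. itinerary T Y n (T x))" for n by (meson not_le)
  note I = simple_function_itinerary[OF Y T]
  have IT: "simple_function M (\<lambda>x. itinerary T Y n (T x))" for n
    by (rule simple_function_compose_measurable[OF I]) (use T in \<open>simp add: invariant_measure_def\<close>)
  have step: "ent M (itinerary T Y (Suc n)) = cond_ent M Y (\<lambda>x. itinerary T Y n (T x)) + ent M (itinerary T Y n)" for n
  proof -
    have "ent M (itinerary T Y (Suc n)) = ent M (\<lambda>x. (Y x, itinerary T Y n (T x)))"
      by (intro ent_cong_det I simple_function_Pair Y IT)
         (simp add: itinerary_Suc)
    then show ?thesis
      using ent_compose_invariant[OF I T] by (simp add: cond_ent_def)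
  qed
  have "real n * e \<le> ent M (itinerary T Y n)" for n
  proof (induction n)
    case 0
    show ?case using ent_nonneg[OF I, of 0] by simp
  next
    case (Suc n)
    then show ?case using ge[of n] step[of n] by (simp add: algebra_simps)
  qed
  then have "e \<le> ent M (itinerary T Y n) / real n" if "1 \<le> n" for n
    using that by (simp add: field_simps)
  then have "e \<le> 0" using LIMSEQ_le_const[OF zero] by blast
  with e show False by simp
qed

text \<open>Small conditional entropy makes \<open>E\<close> close to a set determined by
  \<open>Z\<close>: each outvoted atom contributes at least \<open>ln 2\<close> times its mass, and
  all other terms are nonnegative.\<close>

lemma cond_ent_small_approx:
  assumes E: "E \<in> sets M" and Z: "simple_function M Z"
  obtains P where "ln 2 * prob {x \<in> space M. (x \<in> E) \<noteq> P (Z x)} \<le> cond_ent M (\<lambda>x. x \<in> E) Z"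
proof
  let ?W = "\<lambda>x. (x \<in> E, Z x)"
  note sE = simple_function_mem[OF E]
  have W: "simple_function M ?W" by (rule simple_function_Pair[OF sE Z])
  let ?I = "?W ` space M"
  let ?p = "\<lambda>w. prob (?W -` {w} \<inter> space M)" and ?q = "\<lambda>z. prob (Z -` {z} \<inter> space M)"
  \<comment> \<open>Majority vote on each fibre of \<open>Z\<close>: an outvoted \<open>w\<close> has at most half the mass of its fibre.\<close>
  define P where "P z \<longleftrightarrow> ?p (False, z) \<le> ?p (True, z)" for z
  have fin: "finite ?I" using W by (rule simple_functionD)
  have q: "?q z = ?p (True, z) + ?p (False, z)" for z
  proof -
    have "Z -` {z} \<inter> space M = (?W -` {(True, z)} \<inter> space M) \<union> (?W -` {(False, z)} \<inter> space M)" by auto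
    then show ?thesis by (simp add: finite_measure_Union simple_functionD[OF W] disjoint_iff)
  qed
  have ce: "cond_ent M (\<lambda>x. x \<in> E) Z = (\<Sum>w\<in>?I. ?p w * (ln (?q (snd w)) - ln (?p w)))"
    using ent_compose_eq[OF W, of snd] by (simp add: cond_ent_def ent_def[of M ?W] algebra_simps sum_subtractf)
  let ?B = "{w \<in> ?I. fst w \<noteq> P (snd w)}"
  have "{x \<in> space M. (x \<in> E) \<noteq> P (Z x)} = (\<Union>w\<in>?B. ?W -` {w} \<inter> space M)" by auto
  also have "prob \<dots> = (\<Sum>w\<in>?B. ?p w)"
    by (rule finite_measure_finite_Union)
       (use fin simple_functionD(2)[OF W] in \<open>auto simp: disjoint_family_on_def\<close>)
  finally have "ln 2 * prob {x \<in> space M. (x \<in> E) \<noteq> P (Z x)} = (\<Sum>w\<in>?B. ln 2 * ?p w)"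
    by (simp add: sum_distrib_left)
  also have "\<dots> \<le> (\<Sum>w\<in>?B. ?p w * (ln (?q (snd w)) - ln (?p w)))"
  proof (rule sum_mono)
    fix w assume "w \<in> ?B"
    then have "2 * ?p w \<le> ?q (snd w)" unfolding q by (cases w) (auto simp: P_def)
    show "ln 2 * ?p w \<le> ?p w * (ln (?q (snd w)) - ln (?p w))"
    proof (cases "?p w = 0")
      case False
      then have pos: "0 < ?p w" by (simp add: zero_less_measure_iff)
      have "ln 2 + ln (?p w) = ln (2 * ?p w)" using pos by (simp add: ln_mult)
      also have "\<dots> \<le> ln (?q (snd w))" using \<open>2 * ?p w \<le> _\<close> pos by (intro ln_mono) auto
      finally show ?thesis using pos by (simp add: mult.commute)
    qed simp
  qed
  also have "\<dots> \<le> (\<Sum>w\<in>?I. ?p w * (ln (?q (snd w)) - ln (?p w)))"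
  proof (rule sum_mono2[OF fin])
    fix w assume "w \<in> ?I - ?B"
    have "?p w \<le> ?q (snd w)" by (cases w, cases "fst w") (auto simp: q)
    then show "0 \<le> ?p w * (ln (?q (snd w)) - ln (?p w))"
      by (cases "?p w = 0") (auto simp: zero_less_measure_iff intro!: mult_nonneg_nonneg ln_mono)
  qed auto
  finally show "ln 2 * prob {x \<in> space M. (x \<in> E) \<noteq> P (Z x)} \<le> cond_ent M (\<lambda>x. x \<in> E) Z"
    unfolding ce .
qed

text \<open>Expresses membership in \<open>F\<close> modulo null sets. Conditional expectation fixes
  the indicator of \<open>U\<close> and contracts the L1 norm, so it moves the indicator of
  \<open>E\<close> by at most twice the distance between the two.\<close>

lemma real_cond_exp_indicator_eq:
  assumes sub: "subalgebra M F" and E: "E \<in> sets M"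
    and ap: "\<And>d. 0 < d \<Longrightarrow> \<exists>U\<in>sets F. prob (sym_diff E U) < d"
  shows "AE x in M. real_cond_exp M F (indicator E) x = indicator E x"
proof -
  interpret finite_measure_subalgebra M F
    by (unfold_locales) (rule sub)
  let ?c = "real_cond_exp M F"
  let ?E = "indicator E :: 'a \<Rightarrow> real"
  have iE: "integrable M ?E" using E by (simp add: integrable_indicator_iff less_top[symmetric])
  have icE: "integrable M (?c ?E)" by (rule real_cond_exp_int(1)[OF iE])
  have bound: "(\<integral>x. \<bar>?c ?E x - ?E x\<bar> \<partial>M) \<le> 2 * d" if d: "0 < d" for d
  proof -
    from ap[OF d] obtain U where U: "U \<in> sets F" "prob (sym_diff E U) < d" by blast
    let ?U = "indicator U :: 'a \<Rightarrow> real"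
    have UM: "U \<in> sets M" using U sub by (auto simp: subalgebra_def)
    have iU: "integrable M ?U" using UM by (simp add: integrable_indicator_iff less_top[symmetric])
    let ?g = "\<lambda>x. ?E x - ?U x"
    have ig: "integrable M ?g" using iE iU by simp
    have g: "(\<lambda>x. \<bar>?g x\<bar>) = indicator (sym_diff E U)" by (auto simp: fun_eq_iff indicator_def)
    have cU: "AE x in M. ?c ?U x = ?U x"
      by (rule real_cond_exp_F_meas) (use iU U in auto)
    have cg: "AE x in M. ?c ?g x = ?c ?E x - ?c ?U x"
      by (rule real_cond_exp_diff[OF iE iU])
    \<comment> \<open>Both signs of the difference are needed to bound an absolute value.\<close>
    have cg': "AE x in M. ?c (\<lambda>x. ?U x - ?E x) x = ?c ?U x - ?c ?E x"
      by (rule real_cond_exp_diff[OF iU iE])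
    have m: "AE x in M. ?c ?g x \<le> ?c (\<lambda>x. \<bar>?g x\<bar>) x"
      using ig by (intro real_cond_exp_mono) auto
    have m': "AE x in M. ?c (\<lambda>x. ?U x - ?E x) x \<le> ?c (\<lambda>x. \<bar>?g x\<bar>) x"
      using ig iU iE by (intro real_cond_exp_mono) auto
    have "(\<integral>x. \<bar>?c ?E x - ?E x\<bar> \<partial>M) \<le> (\<integral>x. ?c (\<lambda>x. \<bar>?g x\<bar>) x + \<bar>?g x\<bar> \<partial>M)"
    proof (rule integral_mono_AE)
      show "integrable M (\<lambda>x. \<bar>?c ?E x - ?E x\<bar>)" using iE icE by simp
      show "integrable M (\<lambda>x. ?c (\<lambda>x. \<bar>?g x\<bar>) x + \<bar>?g x\<bar>)"
        using ig by (intro Bochner_Integration.integrable_add real_cond_exp_int(1)) auto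
      show "AE x in M. \<bar>?c ?E x - ?E x\<bar> \<le> ?c (\<lambda>x. \<bar>?g x\<bar>) x + \<bar>?g x\<bar>"
        using cU cg cg' m m' by eventually_elim auto
    qed
    also have "\<dots> = (\<integral>x. ?c (\<lambda>x. \<bar>?g x\<bar>) x \<partial>M) + (\<integral>x. \<bar>?g x\<bar> \<partial>M)"
      using ig by (intro Bochner_Integration.integral_add real_cond_exp_int(1)) auto
    also have "(\<integral>x. ?c (\<lambda>x. \<bar>?g x\<bar>) x \<partial>M) = (\<integral>x. \<bar>?g x\<bar> \<partial>M)"
      using ig by (intro real_cond_exp_int(2)) auto
    also have "(\<integral>x. \<bar>?g x\<bar> \<partial>M) = prob (sym_diff E U)"
      unfolding g using E UM by simp
    finally show ?thesis using U(2) by simp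
  qed
  have "(\<integral>x. \<bar>?c ?E x - ?E x\<bar> \<partial>M) \<le> 0"
  proof (rule field_le_epsilon)
    fix e :: real assume "0 < e"
    then show "(\<integral>x. \<bar>?c ?E x - ?E x\<bar> \<partial>M) \<le> 0 + e" using bound[of "e / 2"] by simp
  qed
  moreover have "0 \<le> (\<integral>x. \<bar>?c ?E x - ?E x\<bar> \<partial>M)" by (rule integral_nonneg_AE) simp
  ultimately have "(\<integral>x. \<bar>?c ?E x - ?E x\<bar> \<partial>M) = 0" by simp
  then have "AE x in M. \<bar>?c ?E x - ?E x\<bar> = 0"
    using iE icE by (subst (asm) integral_nonneg_eq_0_iff_AE) auto
  then show ?thesis by eventually_elim simp
qed

end

subsection \<open>Bipermutative cellular automata\<close>

locale bipermutative_system = prob_space \<mu> for \<mu> :: "(nat \<Rightarrow> 'a::finite) measure" +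
  fixes \<tau> :: "(nat \<Rightarrow> 'a) \<Rightarrow> nat \<Rightarrow> 'a" and r :: "'a \<Rightarrow> 'a \<Rightarrow> 'a"
  assumes sets_mu: "sets \<mu> = sets seq_borel"
    and shift_invariant: "invariant_measure \<mu> shift"
    and tau_invariant: "invariant_measure \<mu> \<tau>"
    and bij_left: "bij (\<lambda>b. r b a)"
    and bij_right: "bij (\<lambda>b. r a b)"
    and tau_eq: "\<tau> x i = r (x i) (x (Suc i))"
begin

abbreviation head :: "(nat \<Rightarrow> 'a) \<Rightarrow> 'a" where
  "head x \<equiv> x 0"

lemma space_mu [simp]: "space \<mu> = UNIV"
  using sets_eq_imp_space_eq[OF sets_mu] by simp

lemma sets_mu_PiM: "sets \<mu> = sets (PiM UNIV (\<lambda>_. count_space UNIV))"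
  by (simp add: sets_mu sets_seq_borel)

lemma measurable_coordinate [measurable]: "(\<lambda>y. y i) \<in> \<mu> \<rightarrow>\<^sub>M count_space UNIV"
  unfolding measurable_cong_sets[OF sets_mu_PiM refl] by (rule measurable_component_singleton) simp

lemma coordinate_sets [measurable]: "{y. y i = a} \<in> sets \<mu>"
  using measurable_sets[OF measurable_coordinate, of "{a}" i] by (simp add: vimage_def)

lemma measurable_shift [measurable]: "shift \<in> \<mu> \<rightarrow>\<^sub>M \<mu>"
  and measurable_tau [measurable]: "\<tau> \<in> \<mu> \<rightarrow>\<^sub>M \<mu>"
  and distr_tau: "distr \<mu> \<mu> \<tau> = \<mu>"
  using shift_invariant tau_invariant by (auto simp: invariant_measure_def)

lemma simple_head: "simple_function \<mu> head"
proof -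
  have "head -` {a} \<in> sets \<mu>" for a
    using coordinate_sets[of 0 a] by (simp add: vimage_def)
  then show ?thesis
    by (auto simp: simple_function_def intro: finite_subset[OF subset_UNIV finite])
qed

lemma shift_tau_commute: "shift (\<tau> x) = \<tau> (shift x)"
  by (simp add: fun_eq_iff shift_def tau_eq)

lemma shift_funpow: "(shift ^^ n) x i = x (n + i)"
  by (induction n arbitrary: i) (simp_all add: shift_def)

lemma itinerary_shift_eq_iff:
  "itinerary shift head n x = itinerary shift head n y \<longleftrightarrow> (\<forall>i<n. x i = y i)"
  by (simp add: itinerary_eq_iff shift_funpow)

text \<open>Right permutativity recovers \<open>x (Suc i)\<close> from \<open>x i\<close> and the
  symbol of \<open>\<tau> x\<close> at \<open>i\<close>. The induction is over all \<open>x\<close>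
  and \<open>y\<close> because its hypothesis is applied to their images under
  \<open>\<tau>\<close>.\<close>

lemma itinerary_tau_eq_iff:
  "itinerary \<tau> head n x = itinerary \<tau> head n y \<longleftrightarrow> (\<forall>i<n. x i = y i)"
proof (induction n arbitrary: x y)
  case 0
  show ?case by (simp add: itinerary_def)
next
  case (Suc n)
  have inj: "r a b = r a c \<longleftrightarrow> b = c" for a b c
    using bij_right[of a] by (auto simp: bij_def dest: injD)
  have "itinerary \<tau> head (Suc n) x = itinerary \<tau> head (Suc n) y \<longleftrightarrow>
      x 0 = y 0 \<and> (\<forall>i<n. r (x i) (x (Suc i)) = r (y i) (y (Suc i)))"
    by (simp add: itinerary_Suc Suc tau_eq)
  also have "\<dots> \<longleftrightarrow> (\<forall>i<Suc n. x i = y i)"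
  proof
    assume *: "x 0 = y 0 \<and> (\<forall>i<n. r (x i) (x (Suc i)) = r (y i) (y (Suc i)))"
    have "i \<le> n \<Longrightarrow> x i = y i" for i
    proof (induction i)
      case (Suc i)
      then have "x i = y i" by simp
      moreover have "r (x i) (x (Suc i)) = r (y i) (y (Suc i))" using * Suc.prems by simp
      ultimately show ?case by (simp add: inj)
    qed (use * in simp)
    then show "\<forall>i<Suc n. x i = y i" by simp
  qed auto
  finally show ?case .
qed

text \<open>The sets approximable by finitely many coordinates contain the generators and are closed
  under complements and countable unions.\<close>

lemma cylinder_approx:
  assumes "E \<in> sets \<mu>" "0 < d"
  shows "\<exists>k U. U \<in> sets \<mu> \<and> prob (sym_diff E U) < d \<and> (\<forall>x y. (\<forall>i<k. x i = y i) \<longrightarrow> (x \<in> U \<longleftrightarrow> y \<in> U))"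
proof -
  have "E \<in> sigma_sets UNIV {{f. f i \<in> A} | i A. True}"
    using assms(1) unfolding sets_mu_PiM sets_PiM_single by simp
  then show ?thesis using assms(2)
  proof (induction arbitrary: d)
    case (Basic E)
    then obtain i A where E: "E = {f. f i \<in> A}" by auto
    have "E \<in> sets \<mu>"
      using measurable_sets[OF measurable_coordinate, of A i] by (simp add: vimage_def E)
    then show ?case using Basic(2)
      by (intro exI[of _ "Suc i"] exI[of _ E]) (auto simp: E)
  next
    case Empty
    then show ?case by (intro exI[of _ 0] exI[of _ "{}"]) auto
  next
    case (Compl E)
    from Compl.IH[OF Compl.prems] obtain k U where U: "U \<in> sets \<mu>" "prob (sym_diff E U) < d"
      and det: "\<forall>x y. (\<forall>i<k. x i = y i) \<longrightarrow> (x \<in> U \<longleftrightarrow> y \<in> U)" by blast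
    have "UNIV - U \<in> sets \<mu>" using sets.compl_sets[OF U(1)] by simp
    moreover have "sym_diff (UNIV - E) (UNIV - U) = sym_diff E U" by auto
    ultimately show ?case using U(2) det
      by (intro exI[of _ k] exI[of _ "UNIV - U"]) auto
  next
    case (Union A)
    have A: "A i \<in> sets \<mu>" for i
      using Union.hyps[of i] unfolding sets_mu_PiM sets_PiM_single by simp
    let ?E = "\<Union>i. A i"
    have "(\<lambda>n. prob (\<Union>i<n. A i)) \<longlonglongrightarrow> prob (\<Union>n. \<Union>i<n. A i)"
      by (intro finite_Lim_measure_incseq incseq_SucI) (use A in \<open>auto simp: lessThan_Suc\<close>)
    also have "(\<Union>n. \<Union>i<n. A i) = ?E" by auto
    finally have "\<forall>\<^sub>F n in sequentially. prob ?E - d / 2 < prob (\<Union>i<n. A i)"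
      using Union.prems by (intro order_tendstoD) auto
    then obtain n where n: "prob ?E - d / 2 < prob (\<Union>i<n. A i)"
      by (auto simp: eventually_sequentially)
    \<comment> \<open>One half of \<open>d\<close> pays for the tail of the union, the other is
      shared by the \<open>n\<close> approximations; \<open>Suc n\<close> keeps the divisor positive
      when \<open>n = 0\<close>.\<close>
    define d' where "d' = d / (2 * real (Suc n))"
    have d': "0 < d'" using Union.prems by (simp add: d'_def)
    have "\<forall>i. \<exists>k U. U \<in> sets \<mu> \<and> prob (sym_diff (A i) U) < d' \<and> (\<forall>x y. (\<forall>i<k. x i = y i) \<longrightarrow> (x \<in> U \<longleftrightarrow> y \<in> U))"
      using Union.IH[OF d'] by blast
    then obtain k U where U: "\<And>i. U i \<in> sets \<mu>" "\<And>i. prob (sym_diff (A i) (U i)) < d'"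
      and det: "\<And>i x y. (\<forall>j<k i. x j = y j) \<Longrightarrow> (x \<in> U i \<longleftrightarrow> y \<in> U i)"
      by metis
    let ?U = "\<Union>i<n. U i"
    have "?U \<in> sets \<mu>" using U by auto
    moreover have "prob (sym_diff ?E ?U) < d"
    proof -
      have "prob (sym_diff ?E ?U) \<le> prob ((?E - (\<Union>i<n. A i)) \<union> (\<Union>i<n. sym_diff (A i) (U i)))"
        using A U(1) by (intro finite_measure_mono) auto
      also have "\<dots> \<le> prob (?E - (\<Union>i<n. A i)) + prob (\<Union>i<n. sym_diff (A i) (U i))"
        using A U(1) by (intro measure_Un_le) auto
      also have "prob (?E - (\<Union>i<n. A i)) = prob ?E - prob (\<Union>i<n. A i)"
        using A by (intro finite_measure_Diff) auto
      also have "prob (\<Union>i<n. sym_diff (A i) (U i)) \<le> (\<Sum>i<n. prob (sym_diff (A i) (U i)))"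
        using A U(1) by (intro finite_measure_subadditive_finite) auto
      also have "\<dots> \<le> (\<Sum>i<n. d')" using U(2) by (intro sum_mono less_imp_le)
      also have "\<dots> \<le> real (Suc n) * d'" using d' by simp
      also have "\<dots> = d / 2" unfolding d'_def by (simp add: divide_simps del: of_nat_Suc)
      finally show ?thesis using n by simp
    qed
    \<comment> \<open>The sum of the lengths serves as a common length, as it dominates each
      \<open>k i\<close>.\<close>
    moreover have "x \<in> ?U \<longleftrightarrow> y \<in> ?U" if eq: "\<forall>j<sum k {..<n}. x j = y j" for x y
    proof -
      have "x \<in> U i \<longleftrightarrow> y \<in> U i" if i: "i < n" for i
      proof (rule det, intro allI impI)
        fix j assume "j < k i"
        also have "k i \<le> sum k {..<n}" using i by (intro member_le_sum) auto
        finally show "x j = y j" using eq by simp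
      qed
      then show ?thesis by auto
    qed
    ultimately show ?case by blast
  qed
qed

text \<open>\<open>zero_rate_transfer\<close> works in both directions with \<open>head\<close>,
  whose itineraries under the two maps have the same fibres; cylinder approximation shows that they
  generate \<open>E\<close>.\<close>

lemma zero_entropy_iff:
  assumes E: "E \<in> sets \<mu>"
  shows "ks_entropy \<mu> shift {E, space \<mu> - E} = 0 \<longleftrightarrow> ks_entropy \<mu> \<tau> {E, space \<mu> - E} = 0"
proof -
  note sE = simple_function_mem[OF E]
  have gen: "\<exists>k. cond_ent \<mu> (\<lambda>x. x \<in> E) (itinerary T head k) < e"
    if e: "0 < e" and T: "T = shift \<or> T = \<tau>" for e T
  proof (rule cond_ent_approx[OF E e _ simple_head])
    show "invariant_measure \<mu> T" using T shift_invariant tau_invariant by auto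
    show "\<exists>k U. U \<in> sets \<mu> \<and> prob (sym_diff E U) < d \<and>
       (\<forall>x\<in>space \<mu>. \<forall>y\<in>space \<mu>. itinerary T head k x = itinerary T head k y \<longrightarrow> (x \<in> U \<longleftrightarrow> y \<in> U))"
      if "0 < d" for d
      using T cylinder_approx[OF E that]
      by (elim disjE) (simp_all add: itinerary_tau_eq_iff itinerary_shift_eq_iff)
  qed
  have same: "itinerary shift head n x = itinerary shift head n y \<longleftrightarrow>
      itinerary \<tau> head n x = itinerary \<tau> head n y" for n x y
    by (simp add: itinerary_tau_eq_iff itinerary_shift_eq_iff)
  show ?thesis
    unfolding ks_entropy_eq_0_iff[OF E shift_invariant] ks_entropy_eq_0_iff[OF E tau_invariant]
  proof
    assume zero: "(\<lambda>n. ent \<mu> (itinerary shift (\<lambda>x. x \<in> E) n) / real n) \<longlonglongrightarrow> 0"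
    show "(\<lambda>n. ent \<mu> (itinerary \<tau> (\<lambda>x. x \<in> E) n) / real n) \<longlonglongrightarrow> 0"
      by (rule zero_rate_transfer[OF shift_invariant tau_invariant shift_tau_commute simple_head sE same _ zero])
         (simp_all add: gen)
  next
    assume zero: "(\<lambda>n. ent \<mu> (itinerary \<tau> (\<lambda>x. x \<in> E) n) / real n) \<longlonglongrightarrow> 0"
    show "(\<lambda>n. ent \<mu> (itinerary shift (\<lambda>x. x \<in> E) n) / real n) \<longlonglongrightarrow> 0"
      by (rule zero_rate_transfer[OF tau_invariant shift_invariant shift_tau_commute[symmetric] simple_head sE same[symmetric] _ zero])
         (simp_all add: gen)
  qed
qed

lemma pinsker_algebra_eq: "pinsker_algebra \<mu> shift = pinsker_algebra \<mu> \<tau>"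
proof -
  have "{A \<in> sets \<mu>. ks_entropy \<mu> shift {A, space \<mu> - A} = 0} =
      {A \<in> sets \<mu>. ks_entropy \<mu> \<tau> {A, space \<mu> - A} = 0}"
    using zero_entropy_iff by blast
  then show ?thesis by (simp only: pinsker_algebra_def)
qed

lemma AE_tau:
  assumes "AE x in \<mu>. P x"
  shows "AE x in \<mu>. P (\<tau> x)"
  by (rule AE_distrD[OF measurable_tau]) (unfold distr_tau, rule assms)

lemma integral_tau:
  fixes f :: "_ \<Rightarrow> real"
  assumes "f \<in> borel_measurable \<mu>"
  shows "(\<integral>x. f (\<tau> x) \<partial>\<mu>) = (\<integral>x. f x \<partial>\<mu>)"
  using integral_distr[OF measurable_tau assms] by (simp add: distr_tau)

text \<open>Almost surely the itinerary repeats one truth value, so its entropy stays bounded while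
  \<open>n\<close> grows.\<close>

lemma ks_entropy_tau_invariant:
  assumes E: "E \<in> sets \<mu>" and inv: "AE x in \<mu>. \<tau> x \<in> E \<longleftrightarrow> x \<in> E"
  shows "ks_entropy \<mu> \<tau> {E, space \<mu> - E} = 0"
  unfolding ks_entropy_eq_0_iff[OF E tau_invariant]
proof (rule tendsto_sandwich[OF _ _ tendsto_const])
  note sE = simple_function_mem[OF E]
  note I = simple_function_itinerary[OF sE tau_invariant]
  have step: "AE x in \<mu>. (\<tau> ^^ i) x \<in> E \<longleftrightarrow> x \<in> E" for i
  proof (induction i)
    case (Suc i)
    from AE_tau[OF Suc] inv show ?case
      by eventually_elim (simp add: funpow_swap1)
  qed simp
  have le: "ent \<mu> (itinerary \<tau> (\<lambda>x. x \<in> E) n) \<le> ent \<mu> (\<lambda>x. x \<in> E)" for n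
  proof -
    have "AE x in \<mu>. \<forall>i. (\<tau> ^^ i) x \<in> E \<longleftrightarrow> x \<in> E"
      using step by (simp add: AE_all_countable)
    then have "AE x in \<mu>. itinerary \<tau> (\<lambda>x. x \<in> E) n x = replicate n (x \<in> E)"
      by eventually_elim (simp add: itinerary_def map_replicate_const)
    then have "ent \<mu> (itinerary \<tau> (\<lambda>x. x \<in> E) n) = ent \<mu> (\<lambda>x. replicate n (x \<in> E))"
      using simple_function_compose[OF sE, of "replicate n"] by (intro ent_cong_AE I) (auto simp: comp_def)
    also have "\<dots> \<le> ent \<mu> (\<lambda>x. x \<in> E)" by (rule ent_mono[OF sE]) simp
    finally show ?thesis .
  qed
  show "\<forall>\<^sub>F n in sequentially. 0 \<le> ent \<mu> (itinerary \<tau> (\<lambda>x. x \<in> E) n) / real n"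
    by (intro always_eventually allI divide_nonneg_nonneg ent_nonneg I) simp
  show "\<forall>\<^sub>F n in sequentially. ent \<mu> (itinerary \<tau> (\<lambda>x. x \<in> E) n) / real n \<le> ent \<mu> (\<lambda>x. x \<in> E) / real n"
    using le by (intro always_eventually allI divide_right_mono) auto
  show "(\<lambda>n. ent \<mu> (\<lambda>x. x \<in> E) / real n) \<longlonglongrightarrow> 0"
    by (rule lim_const_over_n)
qed

end

section \<open>Conditional measures on the fibres of the shift\<close>

locale bipermutative_conditional = bipermutative_system +
  fixes \<kappa>
  assumes conditional: "conditional_measures \<mu> (shift_past \<mu>) \<kappa>"
begin

definition "F = shift_past \<mu>"

lemma space_F [simp]: "space F = UNIV"
  by (simp add: F_def shift_past_def)

lemma subalgebra_F: "subalgebra \<mu> F"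
  and measurable_kappa: "\<kappa> \<in> F \<rightarrow>\<^sub>M prob_algebra \<mu>"
  and kappa_eq_cond_exp: "A \<in> sets \<mu> \<Longrightarrow> AE x in \<mu>. measure (\<kappa> x) A = real_cond_exp \<mu> F (indicator A) x"
  using conditional by (auto simp: conditional_measures_def F_def)

sublocale finite_measure_subalgebra \<mu> F
  by unfold_locales (rule subalgebra_F)

lemma sets_F: "sets F = {shift -` A | A. A \<in> sets \<mu>}"
  unfolding F_def shift_past_def by (subst sets_vimage_algebra2) auto

text \<open>\<open>F\<close> consists of exact preimages under \<open>shift\<close>, with no null
  sets added, so constancy holds on every fibre and not just on almost every one.\<close>

lemma F_measurable_const:
  assumes "f \<in> F \<rightarrow>\<^sub>M N" "{f x} \<in> sets N" "shift y = shift x"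
  shows "f y = f x"
proof -
  have "f -` {f x} \<in> sets F" using measurable_sets[OF assms(1,2)] by simp
  then obtain A where "f -` {f x} = shift -` A" by (auto simp: sets_F)
  then show ?thesis using assms(3) by (metis singletonD singletonI vimage_eq)
qed

lemma tau_measurable_F: "\<tau> \<in> F \<rightarrow>\<^sub>M F"
proof (rule measurableI)
  fix A assume "A \<in> sets F"
  then obtain B where B: "A = shift -` B" "B \<in> sets \<mu>" by (auto simp: sets_F)
  have "\<tau> -` A \<inter> space F = shift -` (\<tau> -` B)" by (auto simp: B(1) shift_tau_commute)
  moreover have "\<tau> -` B \<in> sets \<mu>" using measurable_sets[OF measurable_tau B(2)] by simp
  ultimately show "\<tau> -` A \<inter> space F \<in> sets F" by (auto simp: sets_F)
qed simp

lemma coordinate_Suc_F: "{y. y (Suc i) = a} \<in> sets F"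
proof -
  have "{y. y (Suc i) = a} = shift -` {y. y i = a}" by (auto simp: shift_def)
  then show ?thesis unfolding sets_F using coordinate_sets by blast
qed

lemma prob_kappa: "prob_space (\<kappa> x)" and sets_kappa [measurable_cong]: "sets (\<kappa> x) = sets \<mu>"
  using measurable_space[OF measurable_kappa, of x] by (auto simp: space_prob_algebra)

lemma space_kappa [simp]: "space (\<kappa> x) = UNIV"
  using sets_eq_imp_space_eq[OF sets_kappa] by simp

lemma measurable_kappa_subprob: "\<kappa> \<in> F \<rightarrow>\<^sub>M subprob_algebra \<mu>"
  using measurable_kappa by (rule measurable_prob_algebraD)

text \<open>Equality everywhere matters later, at a point obtained by changing the first symbol,
  which an almost sure statement might miss.\<close>

lemma kappa_cong:
  assumes "shift y = shift x"
  shows "\<kappa> y = \<kappa> x"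
proof (rule measure_eqI)
  fix A assume "A \<in> sets (\<kappa> y)"
  then have A: "A \<in> sets \<mu>" by (simp add: sets_kappa)
  have "(\<lambda>x. emeasure (\<kappa> x) A) \<in> borel_measurable F"
    using measurable_emeasure_kernel[OF measurable_kappa_subprob A] .
  then show "emeasure (\<kappa> y) A = emeasure (\<kappa> x) A"
    by (rule F_measurable_const) (use assms in auto)
qed (simp add: sets_kappa)

text \<open>Events about a single coordinate from 1 on lie in \<open>F\<close>, so almost surely
  they get mass 0 or 1; there are countably many of them.\<close>

lemma AE_kappa_fibre: "AE x in \<mu>. AE y in \<kappa> x. shift y = shift x"
proof -
  have "AE x in \<mu>. measure (\<kappa> x) {y. y (Suc i) = a} = indicator {y. y (Suc i) = a} x" for i a
  proof -
    have "AE x in \<mu>. real_cond_exp \<mu> F (indicator {y. y (Suc i) = a}) x = (indicator {y. y (Suc i) = a} x :: real)"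
      by (rule real_cond_exp_F_meas)
         (use coordinate_Suc_F in \<open>auto simp: integrable_indicator_iff less_top[symmetric]\<close>)
    with kappa_eq_cond_exp[OF coordinate_sets[of "Suc i" a]] show ?thesis by eventually_elim simp
  qed
  then have "AE x in \<mu>. \<forall>i. \<forall>a. measure (\<kappa> x) {y. y (Suc i) = a} = indicator {y. y (Suc i) = a} x"
    by (simp add: AE_all_countable)
  then show ?thesis
  proof eventually_elim
    case (elim x)
    interpret K: prob_space "\<kappa> x" by (rule prob_kappa)
    have "AE y in \<kappa> x. y (Suc i) = x (Suc i)" for i
    proof -
      have "{y. y (Suc i) = x (Suc i)} \<in> sets (\<kappa> x)" by (simp add: sets_kappa coordinate_sets)
      from K.AE_in_set_eq_1[OF this] elim show ?thesis by simp
    qed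
    then have "AE y in \<kappa> x. \<forall>i. y (Suc i) = x (Suc i)" by (simp add: AE_all_countable)
    then show ?case by eventually_elim (simp add: shift_def)
  qed
qed

definition p :: "'a \<Rightarrow> (nat \<Rightarrow> 'a) \<Rightarrow> real" where
  "p a x = measure (\<kappa> x) {y. y 0 = a}"

text \<open>The function of the theorem. While \<open>p a\<close> depends on \<open>shift x\<close>
  only, \<open>J\<close> picks the weight of the actual first symbol.\<close>

definition J :: "(nat \<Rightarrow> 'a) \<Rightarrow> real" where
  "J x = measure (\<kappa> x) {x}"

lemma p_measurable_F [measurable]: "p a \<in> borel_measurable F"
  unfolding p_def[abs_def]
  by (rule measurable_compose[OF measurable_kappa_subprob measurable_measure_subprob_algebra[OF coordinate_sets]])

lemma p_measurable [measurable]: "p a \<in> borel_measurable \<mu>"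
  by (rule measurable_from_subalg[OF subalgebra_F p_measurable_F])

lemma p_bounds: "0 \<le> p a x" "p a x \<le> 1"
  by (simp_all add: p_def prob_space.prob_le_1[OF prob_kappa])

lemma sum_p: "(\<Sum>a\<in>UNIV. p a x) = 1"
proof -
  interpret K: prob_space "\<kappa> x" by (rule prob_kappa)
  have "(\<Sum>a\<in>UNIV. p a x) = K.prob (\<Union>a\<in>UNIV. {y. y 0 = a})"
    unfolding p_def
    by (rule K.finite_measure_finite_Union[symmetric])
       (auto simp: sets_kappa coordinate_sets disjoint_family_on_def)
  also have "(\<Union>a\<in>UNIV. {y. y 0 = a}) = space (\<kappa> x)" by auto
  finally show ?thesis using K.prob_space by simp
qed

lemma singleton_sets: "{x} \<in> sets \<mu>"
proof -
  have "{x} = {y \<in> space \<mu>. \<forall>i. y i = x i}" by auto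
  also have "\<dots> \<in> sets \<mu>" by measurable
  finally show ?thesis .
qed

text \<open>Within a fibre of \<open>shift\<close> a point is determined by its symbol at 0.\<close>

lemma measure_kappa_singleton:
  assumes fibre: "AE y in \<kappa> x. shift y = shift x" and y: "shift y = shift x"
  shows "measure (\<kappa> x) {y} = p (y 0) x"
proof -
  interpret K: prob_space "\<kappa> x" by (rule prob_kappa)
  have ext: "z = y \<longleftrightarrow> z 0 = y 0" if "shift z = shift x" for z
  proof
    assume "z 0 = y 0"
    moreover have "z (Suc i) = y (Suc i)" for i
      using that y by (metis shift_def)
    ultimately have "z i = y i" for i by (cases i) auto
    then show "z = y" by auto
  qed simp
  show ?thesis unfolding p_def
    using fibre by (intro K.finite_measure_eq_AE) (auto simp: sets_kappa singleton_sets coordinate_sets ext)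
qed

lemma AE_J_eq_p: "AE x in \<mu>. J x = p (x 0) x"
  using AE_kappa_fibre by eventually_elim (simp add: J_def measure_kappa_singleton)

text \<open>The measured set moves with \<open>x\<close>, so measurability of the diagonal in the
  product is what is required.\<close>

lemma J_measurable [measurable]: "J \<in> borel_measurable \<mu>"
proof -
  have "{z \<in> space (\<mu> \<Otimes>\<^sub>M \<mu>). \<forall>i. fst z i = snd z i} \<in> sets (\<mu> \<Otimes>\<^sub>M \<mu>)"
    by measurable
  also have "{z \<in> space (\<mu> \<Otimes>\<^sub>M \<mu>). \<forall>i. fst z i = snd z i} = (SIGMA x:space \<mu>. {x})"
    by (auto simp: space_pair_measure)
  finally show ?thesis
    unfolding J_def[abs_def]
    using measurable_from_subalg[OF subalgebra_F measurable_kappa_subprob]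
    by (rule measure_measurable_subprob_algebra2)
qed

section \<open>Invariance of \<open>J\<close> under \<open>\<tau>\<close>\<close>

lemma integral_mult_p:
  assumes G: "G \<in> borel_measurable F" and bd: "\<And>x. \<bar>G x\<bar> \<le> 1"
  shows "(\<integral>x. G x * indicator {y. y 0 = a} x \<partial>\<mu>) = (\<integral>x. G x * p a x \<partial>\<mu>)"
proof -
  have GM [measurable]: "G \<in> borel_measurable \<mu>"
    by (rule measurable_from_subalg[OF subalgebra_F G])
  have "integrable \<mu> (\<lambda>x. G x * indicator {y. y 0 = a} x)"
    by (rule integrable_const_bound[of _ 1]) (use bd in \<open>auto simp: indicator_def\<close>)
  then have "(\<integral>x. G x * indicator {y. y 0 = a} x \<partial>\<mu>) =
      (\<integral>x. G x * real_cond_exp \<mu> F (indicator {y. y 0 = a}) x \<partial>\<mu>)"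
    by (intro real_cond_exp_intg(2)[symmetric] G) auto
  also have "\<dots> = (\<integral>x. G x * p a x \<partial>\<mu>)"
  proof (rule integral_cong_AE)
    show "AE x in \<mu>. G x * real_cond_exp \<mu> F (indicator {y. y 0 = a}) x = G x * p a x"
      using kappa_eq_cond_exp[OF coordinate_sets[of 0 a]] by eventually_elim (simp add: p_def)
  qed auto
  finally show ?thesis .
qed

lemma AE_p_tau: "AE x in \<mu>. \<forall>a. p (r a (x 1)) (\<tau> x) = p a x"
proof -
  \<comment> \<open>\<open>e a b\<close> tests whether first symbol \<open>a\<close> would be sent
    to \<open>b\<close>. It reads only \<open>x 1\<close>, so it is \<open>F\<close>-measurable, and
    \<open>v b\<close> becomes the conditional probability that \<open>\<tau> x\<close> starts with
    \<open>b\<close>.\<close>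
  define e where "e a b x = (if r a (x 1) = b then 1 else 0 :: real)" for a b and x :: "nat \<Rightarrow> 'a"
  define u where "u b x = p b (\<tau> x)" for b x
  define v where "v b x = (\<Sum>a\<in>UNIV. e a b x * p a x)" for b x
  have inj: "r a c = r a' c \<longleftrightarrow> a = a'" for a a' c
    using bij_left[of c] by (auto simp: bij_def dest: injD)
  \<comment> \<open>By left permutativity exactly one first symbol is sent to a given
    \<open>b\<close>, so a single term survives.\<close>
  have v_r: "v (r a (x 1)) x = p a x" for a x
    unfolding v_def e_def inj by (subst sum.remove[of _ a]) auto
  have eF [measurable]: "e a b \<in> borel_measurable F" for a b
  proof -
    have "e a b = (\<lambda>x. \<Sum>c\<in>UNIV. (if r a c = b then 1 else 0) * indicator {y. y (Suc 0) = c} x)"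
      by (auto simp: e_def fun_eq_iff indicator_def)
    also have "\<dots> \<in> borel_measurable F"
      by (intro borel_measurable_sum borel_measurable_times borel_measurable_const borel_measurable_indicator coordinate_Suc_F)
    finally show ?thesis .
  qed
  have uF [measurable]: "u b \<in> borel_measurable F" for b
    unfolding u_def[abs_def] by (rule measurable_compose[OF tau_measurable_F p_measurable_F])
  have vF [measurable]: "v b \<in> borel_measurable F" for b
    unfolding v_def[abs_def] by measurable
  have uM [measurable]: "u b \<in> borel_measurable \<mu>" and vM [measurable]: "v b \<in> borel_measurable \<mu>"
    and eM [measurable]: "e a b \<in> borel_measurable \<mu>" for a b
    using uF vF eF by (auto intro: measurable_from_subalg[OF subalgebra_F])
  have u01: "0 \<le> u b x" "u b x \<le> 1" for b x by (simp_all add: u_def p_bounds)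
  have v01: "0 \<le> v b x" "v b x \<le> 1" for b x
  proof -
    obtain a where "b = r a (x 1)" using bij_left[of "x 1"] by (metis bij_pointE)
    then show "0 \<le> v b x" "v b x \<le> 1" by (simp_all only: v_r p_bounds)
  qed
  have int: "integrable \<mu> (\<lambda>x. f x * g x)"
    if "f \<in> borel_measurable \<mu>" "g \<in> borel_measurable \<mu>" "\<And>x. 0 \<le> f x" "\<And>x. f x \<le> 1" "\<And>x. 0 \<le> g x" "\<And>x. g x \<le> 1"
    for f g :: "_ \<Rightarrow> real"
    by (rule integrable_const_bound[of _ 1]) (use that in \<open>auto intro!: mult_le_one\<close>)
  have uu: "(\<integral>x. u b x * u b x \<partial>\<mu>) = (\<integral>x. p b x * p b x \<partial>\<mu>)" for b
    unfolding u_def by (rule integral_tau) measurable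
  \<comment> \<open>\<open>u b\<close> and \<open>e a b\<close> are \<open>F\<close>-measurable, so
    \<open>p a\<close> may be replaced by the indicator of first symbol \<open>a\<close>. The sum
    then collapses to the event that \<open>\<tau> x\<close> starts with \<open>b\<close>, and
    invariance removes \<open>\<tau>\<close>.\<close>
  have uv: "(\<integral>x. u b x * v b x \<partial>\<mu>) = (\<integral>x. p b x * p b x \<partial>\<mu>)" for b
  proof -
    let ?Z = "\<lambda>a. {y :: nat \<Rightarrow> 'a. y 0 = a}"
    have ue01: "0 \<le> u b x * e a b x" "u b x * e a b x \<le> 1" for a x
      using u01[of b x] by (auto simp: e_def)
    have "(\<integral>x. u b x * v b x \<partial>\<mu>) = (\<integral>x. (\<Sum>a\<in>UNIV. (u b x * e a b x) * p a x) \<partial>\<mu>)"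
      by (simp add: v_def sum_distrib_left mult.assoc)
    also have "\<dots> = (\<Sum>a\<in>UNIV. \<integral>x. (u b x * e a b x) * p a x \<partial>\<mu>)"
      by (rule Bochner_Integration.integral_sum, rule int) (use ue01 p_bounds in auto)
    also have "\<dots> = (\<Sum>a\<in>UNIV. \<integral>x. (u b x * e a b x) * indicator (?Z a) x \<partial>\<mu>)"
    proof (intro sum.cong refl integral_mult_p[symmetric])
      show "\<bar>u b x * e a b x\<bar> \<le> 1" for a x using ue01[of x a] by simp
    qed measurable
    also have "\<dots> = (\<integral>x. (\<Sum>a\<in>UNIV. (u b x * e a b x) * indicator (?Z a) x) \<partial>\<mu>)"
      by (rule Bochner_Integration.integral_sum[symmetric], rule int) (use ue01 in auto)
    also have "\<dots> = (\<integral>x. p b (\<tau> x) * indicator (?Z b) (\<tau> x) \<partial>\<mu>)"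
    proof (intro Bochner_Integration.integral_cong refl)
      fix x
      have "(\<Sum>a\<in>UNIV. (u b x * e a b x) * indicator (?Z a) x) = u b x * e (x 0) b x"
        by (subst sum.remove[of _ "x 0"]) auto
      then show "(\<Sum>a\<in>UNIV. (u b x * e a b x) * indicator (?Z a) x) = p b (\<tau> x) * indicator (?Z b) (\<tau> x)"
        by (simp add: u_def e_def tau_eq indicator_def)
    qed
    also have "\<dots> = (\<integral>x. p b x * indicator (?Z b) x \<partial>\<mu>)"
      by (rule integral_tau) measurable
    also have "\<dots> = (\<integral>x. p b x * p b x \<partial>\<mu>)"
      by (rule integral_mult_p) (simp_all add: p_bounds abs_of_nonneg)
    finally show ?thesis .
  qed
  have vv: "(\<Sum>b\<in>UNIV. v b x * v b x) = (\<Sum>a\<in>UNIV. p a x * p a x)" for x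
  proof -
    have "(\<Sum>b\<in>UNIV. v b x * v b x) = (\<Sum>a\<in>UNIV. v (r a (x 1)) x * v (r a (x 1)) x)"
      by (rule sum.reindex_bij_betw[OF bij_left, symmetric])
    then show ?thesis by (simp only: v_r)
  qed
  \<comment> \<open>Summed over \<open>b\<close>, the integrals of both squares and of the mixed
    product are the same number, so the expanded square integrates to zero.\<close>
  have "(\<integral>x. (\<Sum>b\<in>UNIV. (u b x - v b x) * (u b x - v b x)) \<partial>\<mu>) =
      (\<integral>x. (\<Sum>b\<in>UNIV. u b x * u b x) + (\<Sum>b\<in>UNIV. v b x * v b x) - 2 * (\<Sum>b\<in>UNIV. u b x * v b x) \<partial>\<mu>)"
    by (intro Bochner_Integration.integral_cong refl)
       (simp add: sum.distrib[symmetric] sum_subtractf[symmetric] sum_distrib_left algebra_simps)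
  also have "\<dots> = (\<Sum>b\<in>UNIV. \<integral>x. u b x * u b x \<partial>\<mu>) + (\<Sum>b\<in>UNIV. \<integral>x. p b x * p b x \<partial>\<mu>)
      - 2 * (\<Sum>b\<in>UNIV. \<integral>x. u b x * v b x \<partial>\<mu>)"
    unfolding vv using int[OF uM uM u01 u01] int[OF uM vM u01 v01] int[OF p_measurable p_measurable p_bounds p_bounds]
    by simp
  also have "\<dots> = 0" by (simp add: uu uv)
  finally have "(\<integral>x. (\<Sum>b\<in>UNIV. (u b x - v b x) * (u b x - v b x)) \<partial>\<mu>) = 0" .
  moreover have "integrable \<mu> (\<lambda>x. \<Sum>b\<in>UNIV. (u b x - v b x) * (u b x - v b x))"
  proof (intro Bochner_Integration.integrable_sum integrable_const_bound[of _ 1] AE_I2)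
    fix b x
    have le_1: "\<bar>u b x - v b x\<bar> \<le> 1" using u01[of b x] v01[of b x] by (simp add: abs_le_iff)
    show "norm ((u b x - v b x) * (u b x - v b x)) \<le> 1"
      unfolding real_norm_def abs_mult by (rule mult_le_one[OF le_1 abs_ge_zero le_1])
  qed measurable
  ultimately have "AE x in \<mu>. (\<Sum>b\<in>UNIV. (u b x - v b x) * (u b x - v b x)) = 0"
    by (subst (asm) integral_nonneg_eq_0_iff_AE) (auto intro!: sum_nonneg)
  then show ?thesis
  proof eventually_elim
    case (elim x)
    then have "u b x = v b x" for b by (subst (asm) sum_nonneg_eq_0_iff) auto
    then show ?case using v_r by (metis u_def)
  qed
qed

lemma AE_J_tau: "AE x in \<mu>. J (\<tau> x) = J x"
  using AE_J_eq_p AE_tau[OF AE_J_eq_p] AE_p_tau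
  by eventually_elim (simp add: tau_eq)

section \<open>Level sets of \<open>J\<close> and uniformity of the conditional measures\<close>

lemma J_le_sets: "{x. J x \<le> c} \<in> sets \<mu>"
proof -
  have "{x \<in> space \<mu>. J x \<le> c} \<in> sets \<mu>" by measurable
  then show ?thesis by simp
qed

lemma J_le_zero_entropy: "ks_entropy \<mu> \<tau> {{x. J x \<le> c}, space \<mu> - {x. J x \<le> c}} = 0"
  by (rule ks_entropy_tau_invariant) (use AE_J_tau J_le_sets in auto)

text \<open>Sublevel sets of \<open>J\<close> have zero entropy for \<open>shift\<close> too, hence
  are approximable by sets in \<open>F\<close>; so \<open>\<kappa> x\<close> gives them mass 0 or 1
  almost surely.\<close>

lemma AE_kappa_J: "AE x in \<mu>. AE y in \<kappa> x. J y = J x"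
proof -
  have "AE x in \<mu>. measure (\<kappa> x) {y. J y \<le> c} = indicator {y. J y \<le> c} x" for c
  proof -
    let ?E = "{y. J y \<le> c}"
    note sE = simple_function_mem[OF J_le_sets[of c]]
    let ?Z = "itinerary shift (\<lambda>x. x \<in> ?E)"
    have zero: "(\<lambda>n. ent \<mu> (?Z n) / real n) \<longlonglongrightarrow> 0"
      using J_le_zero_entropy[of c] zero_entropy_iff[OF J_le_sets[of c]]
        ks_entropy_eq_0_iff[OF J_le_sets[of c] shift_invariant] by blast
    have "\<exists>U\<in>sets F. prob (sym_diff ?E U) < d" if d: "0 < d" for d
    proof -
      obtain n where n: "cond_ent \<mu> (\<lambda>x. x \<in> ?E) (\<lambda>x. ?Z n (shift x)) < ln 2 * d"
        using zero_rate_cond_ent[OF sE shift_invariant zero, of "ln 2 * d"] d by auto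
      note Z = simple_function_itinerary[OF sE shift_invariant, of n]
      obtain P where P: "ln 2 * prob {x \<in> space \<mu>. (x \<in> ?E) \<noteq> P (?Z n (shift x))} \<le>
          cond_ent \<mu> (\<lambda>x. x \<in> ?E) (\<lambda>x. ?Z n (shift x))"
        by (rule cond_ent_small_approx[OF J_le_sets simple_function_compose_measurable[OF Z measurable_shift]])
      \<comment> \<open>The majority vote reads the itinerary of \<open>shift x\<close>, so its
        preimage under \<open>shift\<close> lies in \<open>F\<close>.\<close>
      let ?B = "{x. P (?Z n x)}"
      have "?Z n -` {z. P z} \<inter> space \<mu> \<in> sets \<mu>" by (rule simple_functionD(2)[OF Z])
      then have "?B \<in> sets \<mu>" by (simp add: vimage_def)
      then have "shift -` ?B \<in> sets F" unfolding sets_F by blast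
      moreover have eq: "sym_diff ?E (shift -` ?B) = {x \<in> space \<mu>. (x \<in> ?E) \<noteq> P (?Z n (shift x))}" by auto
      have "prob (sym_diff ?E (shift -` ?B)) < d" using le_less_trans[OF P n] unfolding eq by simp
      ultimately show ?thesis by blast
    qed
    then have "AE x in \<mu>. real_cond_exp \<mu> F (indicator ?E) x = indicator ?E x"
      by (rule real_cond_exp_indicator_eq[OF subalgebra_F J_le_sets])
    with kappa_eq_cond_exp[OF J_le_sets[of c]] show ?thesis by eventually_elim simp
  qed
  \<comment> \<open>Rational thresholds allow a single null set and still separate distinct values
    of \<open>J\<close>.\<close>
  then have "AE x in \<mu>. \<forall>q :: rat. measure (\<kappa> x) {y. J y \<le> of_rat q} = indicator {y. J y \<le> of_rat q} x"
    by (simp add: AE_all_countable)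
  then show ?thesis
  proof eventually_elim
    case (elim x)
    interpret K: prob_space "\<kappa> x" by (rule prob_kappa)
    have "AE y in \<kappa> x. J y \<le> of_rat q \<longleftrightarrow> J x \<le> of_rat q" for q
    proof (cases "J x \<le> of_rat q")
      case True
      then have "K.prob {y. J y \<le> of_rat q} = 1" using elim by simp
      from K.AE_prob_1[OF this] show ?thesis using True by simp
    next
      case False
      then have "K.prob {y. J y \<le> of_rat q} = 0" using elim by simp
      then have "AE y in \<kappa> x. y \<notin> {y. J y \<le> of_rat q}"
        using J_le_sets K.prob_eq_0[of "{y. J y \<le> of_rat q}"] by (simp add: sets_kappa)
      then show ?thesis using False by simp
    qed
    then have "AE y in \<kappa> x. \<forall>q :: rat. J y \<le> of_rat q \<longleftrightarrow> J x \<le> of_rat q"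
      by (simp add: AE_all_countable)
    then show ?case
    proof eventually_elim
      case (elim y)
      show "J y = J x"
      proof (rule ccontr)
        assume "J y \<noteq> J x"
        then have "min (J y) (J x) < max (J y) (J x)" by auto
        then obtain q where "min (J y) (J x) < of_rat q" "of_rat q < max (J y) (J x)"
          using of_rat_dense by blast
        then show False using elim[rule_format, of q] by (auto simp: min_def max_def split: if_splits)
      qed
    qed
  qed
qed

text \<open>\<open>S\<close> is the support of the weights. All of them equal \<open>J x\<close> and
  they sum to 1, which makes \<open>S\<close> nonempty and \<open>J x\<close> the reciprocal of its
  cardinality.\<close>

lemma AE_uniform:
  "AE x in \<mu>. \<exists>S. S \<noteq> {} \<and> distr (\<kappa> x) (count_space UNIV) head = uniform_measure (count_space UNIV) S"
  using AE_kappa_fibre AE_kappa_J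
proof eventually_elim
  case (elim x)
  interpret K: prob_space "\<kappa> x" by (rule prob_kappa)
  define S where "S = {a. p a x \<noteq> 0}"
  have pS: "p a x = J x" if "a \<in> S" for a
  proof -
    \<comment> \<open>The point in the fibre of \<open>x\<close> that starts with
      \<open>a\<close>.\<close>
    define y where "y = case_nat a (shift x)"
    have y: "shift y = shift x" "y 0 = a" by (simp_all add: y_def shift_def fun_eq_iff)
    have m: "measure (\<kappa> x) {y} = p a x" using measure_kappa_singleton[OF elim(1) y(1)] y(2) by simp
    have "J y = J x"
    proof (rule ccontr)
      assume ne: "J y \<noteq> J x"
      \<comment> \<open>A point of positive mass cannot lie in the exceptional null set, so the
        constancy of \<open>J\<close> holds at \<open>y\<close> itself.\<close>
      have "AE z in \<kappa> x. z \<notin> {y}" using elim(2) by eventually_elim (use ne in auto)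
      then have "measure (\<kappa> x) {y} = 0"
        using K.prob_eq_0[of "{y}"] by (simp add: sets_kappa singleton_sets)
      with m that show False by (simp add: S_def)
    qed
    then show ?thesis using m kappa_cong[OF y(1)] by (simp add: J_def)
  qed
  have "1 = (\<Sum>a\<in>S. p a x)"
    using sum_p[of x] by (simp add: S_def sum.mono_neutral_right[of UNIV "{a. p a x \<noteq> 0}"])
  then have card: "1 = real (card S) * J x" by (simp add: pS)
  then have "S \<noteq> {}" by auto
  moreover have "distr (\<kappa> x) (count_space UNIV) head = uniform_measure (count_space UNIV) S"
  proof (rule measure_eqI_finite[of _ UNIV])
    have head: "head \<in> \<kappa> x \<rightarrow>\<^sub>M count_space UNIV"
      unfolding measurable_cong_sets[OF sets_kappa refl] by (rule measurable_coordinate)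
    fix a :: 'a
    have "emeasure (distr (\<kappa> x) (count_space UNIV) head) {a} = ennreal (p a x)"
      by (simp add: emeasure_distr[OF head] vimage_def K.emeasure_eq_measure p_def)
    also have "\<dots> = emeasure (uniform_measure (count_space UNIV) S) {a}"
    proof (cases "a \<in> S")
      case True
      have "p a x = 1 / real (card S)" using card pS[OF True] by (cases "card S = 0") (auto simp: field_simps)
      then show ?thesis using True \<open>S \<noteq> {}\<close>
        by (simp add: emeasure_count_space divide_ennreal[symmetric] card_gt_0_iff ennreal_of_nat_eq_real_of_nat)
    next
      case False
      then have "p a x = 0" by (simp add: S_def)
      with False show ?thesis by simp
    qed
    finally show "emeasure (distr (\<kappa> x) (count_space UNIV) head) {a} =
        emeasure (uniform_measure (count_space UNIV) S) {a}" .
  qed simp_all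
  ultimately show ?case by blast
qed

text \<open>The sublevel sets are themselves generators of the Pinsker algebra.\<close>

lemma J_pinsker_tau: "J \<in> borel_measurable (pinsker_algebra \<mu> \<tau>)"
proof -
  have sub: "{A \<in> sets \<mu>. ks_entropy \<mu> \<tau> {A, space \<mu> - A} = 0} \<subseteq> Pow (space \<mu>)" by auto
  have "{x. J x \<le> c} \<in> sets (pinsker_algebra \<mu> \<tau>)" for c
    unfolding pinsker_algebra_def sets_measure_of[OF sub]
    using J_le_sets J_le_zero_entropy by (intro sigma_sets.Basic) blast
  then show ?thesis by (simp add: borel_measurable_iff_le pinsker_algebra_def)
qed

end

theorem theorem4p5:
  fixes \<tau> :: "(nat \<Rightarrow> 'a::finite) \<Rightarrow> nat \<Rightarrow> 'a"
    and \<mu> :: "(nat \<Rightarrow> 'a) measure"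
    and \<kappa> :: "(nat \<Rightarrow> 'a) \<Rightarrow> (nat \<Rightarrow> 'a) measure"
  assumes "bipermutative_ca \<tau>"
    and "prob_space \<mu>"
    and "sets \<mu> = sets seq_borel"
    and "invariant_measure \<mu> shift"
    and "invariant_measure \<mu> \<tau>"
    and "conditional_measures \<mu> (shift_past \<mu>) \<kappa>"
  shows "(AE x in \<mu>. measure (\<kappa> (\<tau> x)) {\<tau> x} = measure (\<kappa> x) {x}) \<and>
    (\<lambda>x. measure (\<kappa> x) {x}) \<in> borel_measurable (pinsker_algebra \<mu> shift) \<and>
    (\<lambda>x. measure (\<kappa> x) {x}) \<in> borel_measurable (pinsker_algebra \<mu> \<tau>) \<and>
    sets (pinsker_algebra \<mu> shift) = sets (pinsker_algebra \<mu> \<tau>) \<and>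
    (AE x in \<mu>. \<exists>S. S \<noteq> {} \<and>
       distr (\<kappa> x) (count_space UNIV) (\<lambda>y. y 0) = uniform_measure (count_space UNIV) S)"
proof -
  obtain r where r: "\<And>a. bij (\<lambda>b. r b a)" "\<And>a. bij (\<lambda>b. r a b)" "\<And>x i. \<tau> x i = r (x i) (x (Suc i))"
    using assms(1) by (auto simp: bipermutative_ca_def)
  interpret prob_space \<mu> by fact
  interpret bipermutative_conditional \<mu> \<tau> r \<kappa>
    by unfold_locales (fact assms(3-6) r)+
  show ?thesis
    \<comment> \<open>Measurability for \<open>shift\<close> is that for \<open>\<tau>\<close>,
      rewritten with the equality of the two Pinsker algebras.\<close>
    using AE_J_tau J_pinsker_tau AE_uniform pinsker_algebra_eq
    unfolding J_def[abs_def] by simp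
qed

end
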